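(* Let $d\ge1$. The Fourier transform $\hat{\ }:L^2(\mathbb{R}^d)\to L^2(\mathbb{R}^d)$ (the extension by density and continuity of the Fourier transform on $L^1\cap L^2(\mathbb{R}^d)$) is a bijective isometry up to a constant factor, with $$\|f\|_{L^2(\mathbb{R}^d)}=(2\pi)^{-d/2}\|\hat f\|_{L^2(\mathbb{R}^d)},\qquad \langle f,g\rangle=(2\pi)^{-d}\langle\hat f,\hat g\rangle,$$ $$(\hat f)\check{\ }=f,\qquad(\check g)\hat{\ }=g,$$ for all $f,g\in L^2(\mathbb{R}^d)$.
   Context: Functions are complex-valued; $\langle f,g\rangle=\int_{\mathbb{R}^d}f(x)\overline{g(x)}\,dx$. For $f\in L^1(\mathbb{R}^d)$, $\hat f(\xi)=\int_{\mathbb{R}^d}f(x)e^{-i\xi x}\,dx$, where $\xi x=\xi_1x_1+\cdots+\xi_dx_d$. The Fourier transform on $L^2(\mathbb{R}^d)$ is the (unique) bounded extension to $L^2(\mathbb{R}^d)$ of this map restricted to $L^1\cap L^2(\mathbb{R}^d)$; that the restriction is bounded in the $L^2$ norm is part of the assertion. The inverse Fourier transform is $\check g(x)=\frac{1}{(2\pi)^d}\hat g(-x)$. *)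

theory Defs
  imports "HOL-Analysis.Analysis"
begin

subsection \<open>Square-integrable functions\<close>

definition square_integrable :: "('a::euclidean_space \<Rightarrow> complex) \<Rightarrow> bool" where
  "square_integrable f \<longleftrightarrow>
     f \<in> borel_measurable lebesgue \<and> integrable lebesgue (\<lambda>x. (norm (f x))\<^sup>2)"

lemma square_integrable_measurable [measurable_dest]:
  "square_integrable f \<Longrightarrow> f \<in> borel_measurable lebesgue"
  by (simp add: square_integrable_def)

lemma square_integrable_integrable:
  "square_integrable f \<Longrightarrow> integrable lebesgue (\<lambda>x. (norm (f x))\<^sup>2)"
  by (simp add: square_integrable_def)

lemma square_integrable_zero: "square_integrable (\<lambda>_. 0)"
  by (simp add: square_integrable_def)

lemma square_integrable_cmult:
  assumes "square_integrable f"
  shows "square_integrable (\<lambda>x. c * f x)"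
  using assms by (auto simp: square_integrable_def norm_mult power_mult_distrib)

lemma norm_add_square_le:
  fixes z w :: "'b::real_normed_vector"
  assumes "t > 0"
  shows "(norm (z + w))\<^sup>2 \<le> (1 + t) * (norm z)\<^sup>2 + (1 + 1 / t) * (norm w)\<^sup>2"
proof -
  have "(norm (z + w))\<^sup>2 \<le> (norm z + norm w)\<^sup>2"
    by (intro power_mono norm_triangle_ineq) auto
  also have "\<dots> \<le> (1 + t) * (norm z)\<^sup>2 + (1 + 1 / t) * (norm w)\<^sup>2"
  proof -
    have "(1 + t) * (norm z)\<^sup>2 + (1 + 1 / t) * (norm w)\<^sup>2 - (norm z + norm w)\<^sup>2
        = (t * norm z - norm w)\<^sup>2 / t"
      using assms by (simp add: field_simps power2_eq_square)
    also have "\<dots> \<ge> 0" using assms by simp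
    finally show ?thesis by simp
  qed
  finally show ?thesis .
qed

lemma square_integrable_add:
  assumes "square_integrable f" "square_integrable g"
  shows "square_integrable (\<lambda>x. f x + g x)"
proof -
  note [measurable] = assms[THEN square_integrable_measurable]
  have "integrable lebesgue (\<lambda>x. (norm (f x + g x))\<^sup>2)"
  proof (rule Bochner_Integration.integrable_bound)
    show "integrable lebesgue (\<lambda>x. 2 * (norm (f x))\<^sup>2 + 2 * (norm (g x))\<^sup>2)"
      using assms by (simp add: square_integrable_def)
    show "AE x in lebesgue. norm ((norm (f x + g x))\<^sup>2) \<le> norm (2 * (norm (f x))\<^sup>2 + 2 * (norm (g x))\<^sup>2)"
      using norm_add_square_le[of 1] by (auto intro!: AE_I2)
  qed measurable
  then show ?thesis by (simp add: square_integrable_def)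
qed

lemma measurable_uminus_lebesgue [measurable]:
  "(uminus :: 'a \<Rightarrow> 'a::euclidean_space) \<in> lebesgue \<rightarrow>\<^sub>M lebesgue"
  using lebesgue_affine_measurable[of "\<lambda>_. -1" "0::'a"]
  by (simp add: euclidean_representation sum_negf scaleR_minus_left cong: sum.cong)

lemma lebesgue_distr_uminus:
  "distr lebesgue lebesgue uminus = (lebesgue :: 'a::euclidean_space measure)"
  using lebesgue_affine_euclidean[of "\<lambda>_. -1" "0::'a"]
  by (simp add: euclidean_representation sum_negf scaleR_minus_left density_1)

lemma square_integrable_reflect:
  fixes f :: "'a::euclidean_space \<Rightarrow> complex"
  assumes "square_integrable f"
  shows "square_integrable (\<lambda>x. f (- x))"
proof -
  note [measurable] = assms[THEN square_integrable_measurable]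
  have "integrable (distr lebesgue lebesgue uminus) (\<lambda>x::'a. (norm (f x))\<^sup>2)"
    using assms by (simp add: lebesgue_distr_uminus square_integrable_def)
  then have "integrable lebesgue (\<lambda>x. (norm (f (- x)))\<^sup>2)"
    by (subst (asm) integrable_distr_eq) auto
  then show ?thesis by (simp add: square_integrable_def)
qed

subsection \<open>The space $L^2(\mathbb{R}^d)$\<close>

text \<open>The Euclidean space type \<open>'a\<close> plays the role of $\mathbb{R}^d$, with $d$ being
  \<open>DIM('a)\<close>.  An element of \<open>'a L2\<close> is a class of square-integrable
  functions modulo equality almost everywhere.\<close>

quotient_type (overloaded) 'a L2 = "'a::euclidean_space \<Rightarrow> complex" / partial:
  "\<lambda>f g. square_integrable f \<and> square_integrable g \<and> (AE x in lebesgue. f x = g x)"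
proof (rule part_equivpI)
  show "\<exists>f::'a \<Rightarrow> complex. square_integrable f \<and> square_integrable f \<and> (AE x in lebesgue. f x = f x)"
    using square_integrable_zero by auto
qed (auto intro!: sympI transpI)

lift_definition L2_inner :: "'a::euclidean_space L2 \<Rightarrow> 'a L2 \<Rightarrow> complex" is
  "\<lambda>f g. \<integral>x. f x * cnj (g x) \<partial>lebesgue"
proof -
  fix f f' g g' :: "'a \<Rightarrow> complex"
  assume f: "square_integrable f \<and> square_integrable f' \<and> (AE x in lebesgue. f x = f' x)"
     and g: "square_integrable g \<and> square_integrable g' \<and> (AE x in lebesgue. g x = g' x)"
  then have [measurable]: "f \<in> borel_measurable lebesgue" "f' \<in> borel_measurable lebesgue"
      "g \<in> borel_measurable lebesgue" "g' \<in> borel_measurable lebesgue"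
    by (auto simp: square_integrable_def)
  have [measurable]: "cnj \<in> borel_measurable borel"
    by (intro borel_measurable_continuous_onI continuous_intros)
  have "AE x in lebesgue. f x * cnj (g x) = f' x * cnj (g' x)"
    using f g by (auto elim: AE_mp)
  then show "(\<integral>x. f x * cnj (g x) \<partial>lebesgue) = (\<integral>x. f' x * cnj (g' x) \<partial>lebesgue)"
    by (intro integral_cong_AE) auto
qed

lift_definition L2_scaleC :: "complex \<Rightarrow> 'a::euclidean_space L2 \<Rightarrow> 'a L2" is
  "\<lambda>c f x. c * f x"
  by (auto intro: square_integrable_cmult)

lift_definition L2_reflect :: "'a::euclidean_space L2 \<Rightarrow> 'a L2" is
  "\<lambda>f x. f (- x)"
proof -
  fix f g :: "'a \<Rightarrow> complex"
  assume fg: "square_integrable f \<and> square_integrable g \<and> (AE x in lebesgue. f x = g x)"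
  then have "AE x in distr lebesgue lebesgue uminus. f x = g x"
    unfolding lebesgue_distr_uminus by blast
  then have "AE x in lebesgue. f (- x) = g (- x)"
    by (rule AE_distrD[OF measurable_uminus_lebesgue])
  then show "square_integrable (\<lambda>x. f (- x)) \<and> square_integrable (\<lambda>x. g (- x)) \<and>
      (AE x in lebesgue. f (- x) = g (- x))"
    using fg square_integrable_reflect by blast
qed

instantiation L2 :: (euclidean_space) ab_group_add
begin

lift_definition zero_L2 :: "'a L2" is "\<lambda>_. 0"
  by (simp add: square_integrable_zero)

lift_definition plus_L2 :: "'a L2 \<Rightarrow> 'a L2 \<Rightarrow> 'a L2" is "\<lambda>f g x. f x + g x"
  by (auto intro: square_integrable_add elim: AE_mp)

lift_definition uminus_L2 :: "'a L2 \<Rightarrow> 'a L2" is "\<lambda>f x. - f x"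
  by (auto dest: square_integrable_cmult[of _ "-1"])

definition minus_L2 :: "'a L2 \<Rightarrow> 'a L2 \<Rightarrow> 'a L2" where
  "minus_L2 f g = f + - g"

instance
proof
  fix a b c :: "'a L2"
  show "a + b + c = a + (b + c)"
    by transfer (auto simp: add.assoc intro!: square_integrable_add)
  show "a + b = b + a"
    by transfer (auto simp: add.commute intro!: square_integrable_add)
  show "0 + a = a"
    by transfer auto
  show "- a + a = 0"
    by transfer (auto simp: square_integrable_zero)
  show "a - b = a + - b"
    by (simp add: minus_L2_def)
qed

end

instantiation L2 :: (euclidean_space) real_vector
begin

definition scaleR_L2 :: "real \<Rightarrow> 'a L2 \<Rightarrow> 'a L2" where
  "scaleR_L2 r f = L2_scaleC (complex_of_real r) f"

instance
proof
  fix f g :: "'a L2" and r s :: real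
  show "r *\<^sub>R (f + g) = r *\<^sub>R f + r *\<^sub>R g"
    unfolding scaleR_L2_def
    by transfer (auto simp: distrib_left intro!: square_integrable_add square_integrable_cmult)
  show "(r + s) *\<^sub>R f = r *\<^sub>R f + s *\<^sub>R f"
    unfolding scaleR_L2_def
  proof transfer
    fix r s :: real and f :: "'a \<Rightarrow> complex"
    assume "square_integrable f \<and> square_integrable f \<and> (AE x in lebesgue. f x = f x)"
    then show "square_integrable (\<lambda>x. complex_of_real (r + s) * f x) \<and>
        square_integrable (\<lambda>x. complex_of_real r * f x + complex_of_real s * f x) \<and>
        (AE x in lebesgue. complex_of_real (r + s) * f x
          = complex_of_real r * f x + complex_of_real s * f x)"
      by (auto simp: ring_distribs intro!: square_integrable_add square_integrable_cmult)
  qed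
  show "r *\<^sub>R s *\<^sub>R f = (r * s) *\<^sub>R f"
    unfolding scaleR_L2_def
    by transfer (auto simp: mult.assoc intro!: square_integrable_cmult)
  show "1 *\<^sub>R f = f"
    unfolding scaleR_L2_def by transfer auto
qed

end

instantiation L2 :: (euclidean_space) real_normed_vector
begin

lift_definition norm_L2 :: "'a L2 \<Rightarrow> real" is
  "\<lambda>f. sqrt (\<integral>x. (norm (f x))\<^sup>2 \<partial>lebesgue)"
proof -
  fix f g :: "'a \<Rightarrow> complex"
  assume fg: "square_integrable f \<and> square_integrable g \<and> (AE x in lebesgue. f x = g x)"
  then have [measurable]: "f \<in> borel_measurable lebesgue" "g \<in> borel_measurable lebesgue"
    by (auto simp: square_integrable_def)
  have "AE x in lebesgue. (norm (f x))\<^sup>2 = (norm (g x))\<^sup>2"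
    using fg by (auto elim: AE_mp)
  then have "(\<integral>x. (norm (f x))\<^sup>2 \<partial>lebesgue) = (\<integral>x. (norm (g x))\<^sup>2 \<partial>lebesgue)"
    by (intro integral_cong_AE) auto
  then show "sqrt (\<integral>x. (norm (f x))\<^sup>2 \<partial>lebesgue) = sqrt (\<integral>x. (norm (g x))\<^sup>2 \<partial>lebesgue)"
    by simp
qed

definition sgn_L2 :: "'a L2 \<Rightarrow> 'a L2" where
  "sgn_L2 f = f /\<^sub>R norm f"

definition dist_L2 :: "'a L2 \<Rightarrow> 'a L2 \<Rightarrow> real" where
  "dist_L2 f g = norm (f - g)"

definition uniformity_L2 :: "('a L2 \<times> 'a L2) filter" where
  "uniformity_L2 = (INF e\<in>{0<..}. principal {(f, g). dist f g < e})"

definition open_L2 :: "'a L2 set \<Rightarrow> bool" where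
  "open_L2 U \<longleftrightarrow> (\<forall>f\<in>U. \<forall>\<^sub>F (f', g) in uniformity. f' = f \<longrightarrow> g \<in> U)"

lemma norm_L2_eq_0: "norm f = 0 \<longleftrightarrow> f = 0" for f :: "'a L2"
proof transfer
  fix f :: "'a \<Rightarrow> complex"
  assume f: "square_integrable f \<and> square_integrable f \<and> (AE x in lebesgue. f x = f x)"
  then have "(\<integral>x. (norm (f x))\<^sup>2 \<partial>lebesgue) = 0 \<longleftrightarrow> (AE x in lebesgue. (norm (f x))\<^sup>2 = 0)"
    by (intro integral_nonneg_eq_0_iff_AE) (auto simp: square_integrable_def)
  then show "sqrt (\<integral>x. (norm (f x))\<^sup>2 \<partial>lebesgue) = 0 \<longleftrightarrow>
      square_integrable f \<and> square_integrable (\<lambda>_::'a. 0) \<and> (AE x in lebesgue. f x = 0)"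
    using f by (simp add: square_integrable_zero)
qed

lemma norm_L2_nonneg: "0 \<le> norm f" for f :: "'a L2"
  by transfer simp

lemma norm_L2_add_square_le:
  fixes f g :: "'a L2"
  assumes "t > 0"
  shows "(norm (f + g))\<^sup>2 \<le> (1 + t) * (norm f)\<^sup>2 + (1 + 1 / t) * (norm g)\<^sup>2"
  using assms
proof transfer
  fix t :: real and f g :: "'a \<Rightarrow> complex"
  assume t: "t > 0"
    and f: "square_integrable f \<and> square_integrable f \<and> (AE x in lebesgue. f x = f x)"
    and g: "square_integrable g \<and> square_integrable g \<and> (AE x in lebesgue. g x = g x)"
  have "(\<integral>x. (norm (f x + g x))\<^sup>2 \<partial>lebesgue)
      \<le> (\<integral>x. (1 + t) * (norm (f x))\<^sup>2 + (1 + 1 / t) * (norm (g x))\<^sup>2 \<partial>lebesgue)"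
    using f g square_integrable_add[of f g] norm_add_square_le[OF t]
    by (intro integral_mono) (auto simp: square_integrable_def)
  also have "\<dots> = (1 + t) * (\<integral>x. (norm (f x))\<^sup>2 \<partial>lebesgue)
      + (1 + 1 / t) * (\<integral>x. (norm (g x))\<^sup>2 \<partial>lebesgue)"
    using f g by (subst Bochner_Integration.integral_add) (auto simp: square_integrable_def)
  finally show "(sqrt (\<integral>x. (norm (f x + g x))\<^sup>2 \<partial>lebesgue))\<^sup>2
      \<le> (1 + t) * (sqrt (\<integral>x. (norm (f x))\<^sup>2 \<partial>lebesgue))\<^sup>2
        + (1 + 1 / t) * (sqrt (\<integral>x. (norm (g x))\<^sup>2 \<partial>lebesgue))\<^sup>2"
    by simp
qed

instance
proof
  fix f g :: "'a L2" and r :: real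
  show "norm f = 0 \<longleftrightarrow> f = 0"
    by (rule norm_L2_eq_0)
  show "norm (r *\<^sub>R f) = \<bar>r\<bar> * norm f"
    unfolding scaleR_L2_def
    by transfer (simp add: norm_mult power_mult_distrib real_sqrt_mult)
  show "norm (f + g) \<le> norm f + norm g"
  proof (cases "norm f = 0 \<or> norm g = 0")
    case True
    then show ?thesis
      using norm_L2_nonneg[of f] norm_L2_nonneg[of g] by (auto simp: norm_L2_eq_0)
  next
    case False
    then have pos: "norm f > 0" "norm g > 0"
      using norm_L2_nonneg[of f] norm_L2_nonneg[of g] by linarith+
    have "(norm (f + g))\<^sup>2 \<le> (1 + norm g / norm f) * (norm f)\<^sup>2
        + (1 + 1 / (norm g / norm f)) * (norm g)\<^sup>2"
      using pos by (intro norm_L2_add_square_le) simp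
    also have "\<dots> = (norm f + norm g)\<^sup>2"
      using pos by (simp add: field_simps power2_eq_square)
    finally show ?thesis
      by (rule power2_le_imp_le) (use pos in simp)
  qed
qed (simp_all add: sgn_L2_def dist_L2_def uniformity_L2_def open_L2_def)

end

subsection \<open>The Fourier transform\<close>

definition fourier :: "('a::euclidean_space \<Rightarrow> complex) \<Rightarrow> 'a \<Rightarrow> complex" where
  "fourier f \<xi> = (\<integral>x. f x * exp (- (\<i> * complex_of_real (\<xi> \<bullet> x))) \<partial>lebesgue)"

definition bounded_clinear_L2 :: "('a::euclidean_space L2 \<Rightarrow> 'a L2) \<Rightarrow> bool" where
  "bounded_clinear_L2 F \<longleftrightarrow>
     bounded_linear F \<and> (\<forall>c f. F (L2_scaleC c f) = L2_scaleC c (F f))"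

text \<open>\<open>abs_L2 f\<close> is the class of \<open>f\<close>; it is only meaningful for square-integrable
  \<open>f\<close>, so that the transforms are required to be square-integrable here.\<close>

definition extends_fourier :: "('a::euclidean_space L2 \<Rightarrow> 'a L2) \<Rightarrow> bool" where
  "extends_fourier F \<longleftrightarrow>
     (\<forall>f. integrable lebesgue f \<and> square_integrable f \<longrightarrow>
        square_integrable (fourier f) \<and> F (abs_L2 f) = abs_L2 (fourier f))"

text \<open>Only meaningful because there is a unique such operator.\<close>

definition fourier_L2 :: "'a::euclidean_space L2 \<Rightarrow> 'a L2" where
  "fourier_L2 = (THE F. bounded_clinear_L2 F \<and> extends_fourier F)"

definition inverse_fourier_L2 :: "'a::euclidean_space L2 \<Rightarrow> 'a L2" where
  "inverse_fourier_L2 g = (1 / (2 * pi) ^ DIM('a)) *\<^sub>R L2_reflect (fourier_L2 g)"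

end

theory Submission
  imports Defs "HOL-Probability.Characteristic_Functions"
begin

text \<open>
  Write \<open>n\<close> for \<open>DIM('a)\<close>, \<open>\<gamma>\<close> for the Gaussian \<open>exp (- |x|^2 / 2)\<close>, \<open>R\<close> for the reflection
  \<open>x \<mapsto> - x\<close> of the argument and \<open>F\<close> for the Fourier transform.  Everything follows from two identities
  for integrable functions, each of them an application of Fubini's theorem: the multiplication formula,
  that the integrals of \<open>F f * g\<close> and \<open>f * F g\<close> agree (\<open>fourier_multiplication_formula\<close>),
  and the autocorrelation formula \<open>F \<phi> = |F f|^2\<close>, where \<open>\<phi> z\<close> is the integral of
  \<open>f x * cnj (f (x - z))\<close> over \<open>x\<close> (\<open>fourier_autocorrelation\<close>).  Pairing \<open>F \<phi>\<close> with the dilated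
  Gaussian \<open>\<gamma> (c \<xi>)\<close>, whose transform is explicit, gives
  (\<open>integral_fourier_square_gauss\<close>)
  \[ \int |\hat f(\xi)|^2 \gamma(c \xi)\,d\xi = (2\pi)^{n/2} \int \varphi(c w) \gamma(w)\,dw. \]

  Since \<open>|\<phi>| \<le> \<phi> 0 = \<parallel>f\<parallel>^2\<close>, the right-hand side is at most \<open>(2 pi)^n * \<parallel>f\<parallel>^2\<close>, and Fatou's lemma
  for \<open>c \<longlonglongrightarrow> 0\<close> bounds \<open>F\<close> on the intersection of the spaces \<open>L1\<close> and \<open>L2\<close>.  If \<open>f\<close> is in
  addition bounded, then \<open>\<phi>\<close> is continuous at 0, because translation is continuous in \<open>L1\<close>; so the
  limit of the right-hand side is exactly \<open>(2 pi)^n * \<parallel>f\<parallel>^2\<close>.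

  The space \<open>L2\<close> is complete (Riesz--Fischer), so \<open>F\<close> extends to it as the limit of its compositions
  with the cutoffs to balls.  Bounded integrable functions are dense, so the norm identity passes
  to all of \<open>L2\<close> by continuity; by polarization, the extension preserves inner products up to the
  factor \<open>(2 pi)^n\<close>.

  Inversion needs no pointwise inversion formula.  By the multiplication formula the adjoint of \<open>F\<close> is
  \<open>R F\<close>; hence the isometry property says that \<open>R F F\<close> is multiplication by \<open>(2 pi)^n\<close>, which is
  the first inversion formula.  As \<open>R\<close> preserves inner products, also
  \<open>\<langle>F R F g, h\<rangle> = \<langle>R F g, R F h\<rangle> = \<langle>F g, F h\<rangle> = (2 pi)^n * \<langle>g, h\<rangle>\<close>,
  which is the second one, and the two together give bijectivity.
\<close>

section \<open>Lebesgue integrals and affine substitutions\<close>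

lemma measurable_cnj [measurable]: "cnj \<in> borel_measurable borel"
  by (intro borel_measurable_continuous_onI continuous_intros)

lemma lborel_integral_affine:
  fixes f :: "'a::euclidean_space \<Rightarrow> 'b::{banach, second_countable_topology}"
  assumes [measurable]: "f \<in> borel_measurable borel" and c: "c \<noteq> 0"
  shows "(\<integral>x. f x \<partial>lborel) = \<bar>c\<bar> ^ DIM('a) *\<^sub>R (\<integral>x. f (t + c *\<^sub>R x) \<partial>lborel)"
  by (subst lborel_affine[OF c, of t]) (simp add: integral_density integral_distr)

lemma lborel_integrable_affine_iff:
  fixes f :: "'a::euclidean_space \<Rightarrow> 'b::{banach, second_countable_topology}"
  assumes [measurable]: "f \<in> borel_measurable borel" and c: "c \<noteq> 0"
  shows "integrable lborel (\<lambda>x. f (t + c *\<^sub>R x)) \<longleftrightarrow> integrable lborel f"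
proof -
  let ?C = "\<bar>c\<bar> ^ DIM('a)" and ?g = "\<lambda>x. f (t + c *\<^sub>R x)"
  have "integrable lborel f \<longleftrightarrow> integrable lborel (\<lambda>x. ?C *\<^sub>R ?g x)"
    by (subst lborel_affine[OF c, of t]) (simp add: integrable_density integrable_distr_eq)
  also have "\<dots> \<longleftrightarrow> integrable lborel ?g"
    using c integrable_scaleR_right[of "inverse ?C" lborel "\<lambda>x. ?C *\<^sub>R ?g x"]
    by (auto intro: integrable_scaleR_right)
  finally show ?thesis by simp
qed

lemma lborel_integral_translate:
  fixes f :: "'a::euclidean_space \<Rightarrow> 'b::{banach, second_countable_topology}"
  assumes [measurable]: "f \<in> borel_measurable borel"
  shows "(\<integral>x. f (x - t) \<partial>lborel) = (\<integral>x. f x \<partial>lborel)"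
  using lborel_integral_affine[of f 1 "- t"] by simp

lemma lborel_integrable_translate:
  fixes f :: "'a::euclidean_space \<Rightarrow> 'b::{banach, second_countable_topology}"
  assumes "integrable lborel f"
  shows "integrable lborel (\<lambda>x. f (x - t))"
  using lborel_integrable_affine_iff[of f 1 "- t"] borel_measurable_integrable[OF assms] assms by simp

lemma lborel_integral_translate_reflect:
  fixes f :: "'a::euclidean_space \<Rightarrow> 'b::{banach, second_countable_topology}"
  assumes [measurable]: "f \<in> borel_measurable borel"
  shows "(\<integral>x. f (t - x) \<partial>lborel) = (\<integral>x. f x \<partial>lborel)"
  using lborel_integral_affine[of f "- 1" t] by simp

lemma lborel_integrable_translate_reflect:
  fixes f :: "'a::euclidean_space \<Rightarrow> 'b::{banach, second_countable_topology}"
  assumes "integrable lborel f"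
  shows "integrable lborel (\<lambda>x. f (t - x))"
  using lborel_integrable_affine_iff[of f "- 1" t] borel_measurable_integrable[OF assms] assms by simp

section \<open>The Fourier transform of integrable functions\<close>

text \<open>For a merely Lebesgue-measurable \<open>f\<close>, the function \<open>f (x - y)\<close> need not be measurable with respect to the product of
  the two Lebesgue \<open>\<sigma>\<close>-algebras.  The Fubini arguments are therefore carried out with \<open>lborel\<close>, and are
  transferred to \<open>lebesgue\<close> by Borel representatives.\<close>

lemma fourier_eq_lborel:
  fixes f :: "'a::euclidean_space \<Rightarrow> complex"
  assumes [measurable]: "f \<in> borel_measurable borel"
  shows "fourier f \<xi> = (\<integral>x. f x * exp (- (\<i> * complex_of_real (\<xi> \<bullet> x))) \<partial>lborel)"
  unfolding fourier_def by (rule integral_completion) measurable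

lemma fourier_measurable [measurable]:
  fixes f :: "'a::euclidean_space \<Rightarrow> complex"
  assumes [measurable]: "f \<in> borel_measurable borel"
  shows "fourier f \<in> borel_measurable borel"
  unfolding fourier_eq_lborel[OF assms, abs_def] by measurable

lemma integrable_fourier_kernel:
  fixes f :: "'a::euclidean_space \<Rightarrow> complex"
  assumes "integrable lborel f"
  shows "integrable lborel (\<lambda>x. f x * exp (- (\<i> * complex_of_real (\<xi> \<bullet> x))))"
  by (rule Bochner_Integration.integrable_bound[OF assms])
     (use borel_measurable_integrable[OF assms] in \<open>auto simp: norm_mult\<close>)

lemma norm_fourier_le:
  fixes f :: "'a::euclidean_space \<Rightarrow> complex"
  assumes "integrable lborel f"
  shows "norm (fourier f \<xi>) \<le> (\<integral>x. norm (f x) \<partial>lborel)"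
  using integral_norm_bound[of lborel "\<lambda>x. f x * exp (- (\<i> * complex_of_real (\<xi> \<bullet> x)))"]
    borel_measurable_integrable[OF assms]
  by (simp add: fourier_eq_lborel norm_mult)

lemma integrable_pair_mult:
  fixes f g :: "'a::euclidean_space \<Rightarrow> complex"
  assumes f: "integrable lborel f" and g: "integrable lborel g"
  shows "integrable (lborel \<Otimes>\<^sub>M lborel) (\<lambda>(x, y). f x * g y)"
proof -
  note [measurable] = borel_measurable_integrable[OF f] borel_measurable_integrable[OF g]
  show ?thesis
    by (rule lborel_pair.Fubini_integrable) (use f g in \<open>auto simp: norm_mult\<close>)
qed

text \<open>Both sides are the double integral of \<open>f x * g y * exp (- (\<i> * (x \<bullet> y)))\<close>, which is absolutely
  integrable since the kernel has modulus 1.\<close>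

lemma fourier_multiplication_formula:
  fixes f g :: "'a::euclidean_space \<Rightarrow> complex"
  assumes f: "integrable lborel f" and g: "integrable lborel g"
  shows "(\<integral>x. fourier f x * g x \<partial>lborel) = (\<integral>x. f x * fourier g x \<partial>lborel)"
proof -
  note [measurable] = borel_measurable_integrable[OF f] borel_measurable_integrable[OF g]
  have int: "integrable (lborel \<Otimes>\<^sub>M lborel)
      (\<lambda>(x, y). f x * g y * exp (- (\<i> * complex_of_real (x \<bullet> y))))"
    by (rule Bochner_Integration.integrable_bound[OF integrable_pair_mult[OF f g]])
       (auto simp: norm_mult)
  have "(\<integral>y. fourier f y * g y \<partial>lborel) =
      (\<integral>y. (\<integral>x. f x * g y * exp (- (\<i> * complex_of_real (x \<bullet> y))) \<partial>lborel) \<partial>lborel)"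
    by (simp add: fourier_eq_lborel inner_commute mult_ac flip: integral_mult_right_zero)
  also have "\<dots> = (\<integral>x. (\<integral>y. f x * g y * exp (- (\<i> * complex_of_real (x \<bullet> y))) \<partial>lborel) \<partial>lborel)"
    by (rule lborel_pair.Fubini_integral[OF int])
  also have "\<dots> = (\<integral>x. f x * fourier g x \<partial>lborel)"
    by (simp add: fourier_eq_lborel mult.assoc)
  finally show ?thesis .
qed

section \<open>The Gaussian\<close>

definition gauss :: "'a::euclidean_space \<Rightarrow> real" where
  "gauss x = exp (- (norm x)\<^sup>2 / 2)"

lemma gauss_nonneg [simp]: "gauss x \<ge> 0"
  and gauss_le_1 [simp]: "gauss x \<le> 1"
  by (simp_all add: gauss_def)

lemma gauss_measurable [measurable]: "gauss \<in> borel_measurable borel"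
  unfolding gauss_def[abs_def] by measurable

lemma gauss_real_eq: "gauss (x::real) = sqrt (2 * pi) * std_normal_density x"
  by (simp add: gauss_def std_normal_density_def)

lemma integrable_gauss_real: "integrable lborel (gauss :: real \<Rightarrow> real)"
  unfolding gauss_real_eq[abs_def] by simp

text \<open>This is the characteristic function of the standard normal distribution, up to normalization.\<close>

lemma fourier_gauss_real:
  "(\<integral>s. complex_of_real (gauss s) * exp (- (\<i> * complex_of_real (t * s))) \<partial>lborel)
     = complex_of_real (sqrt (2 * pi) * gauss (t :: real))"
proof -
  have "char std_normal_distribution (- t) =
      (\<integral>s. std_normal_density s *\<^sub>R exp (\<i> * complex_of_real (- t * s)) \<partial>lborel)"
    unfolding char_def by (subst integral_density) (auto simp: normal_density_nonneg)
  then have "(\<integral>s. std_normal_density s *\<^sub>R exp (- (\<i> * complex_of_real (t * s))) \<partial>lborel)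
      = complex_of_real (gauss t)"
    by (simp add: char_std_normal_distribution gauss_def)
  then have "complex_of_real (sqrt (2 * pi)) *
      (\<integral>s. std_normal_density s *\<^sub>R exp (- (\<i> * complex_of_real (t * s))) \<partial>lborel)
      = complex_of_real (sqrt (2 * pi)) * complex_of_real (gauss t)"
    by simp
  then show ?thesis
    by (simp add: gauss_real_eq scaleR_conv_of_real mult.assoc flip: integral_mult_right_zero)
qed

lemma gauss_eq_prod: "gauss x = (\<Prod>b\<in>Basis. gauss (x \<bullet> b))"
proof -
  have "(norm x)\<^sup>2 = (\<Sum>b\<in>Basis. (x \<bullet> b)\<^sup>2)"
    unfolding power2_norm_eq_inner euclidean_inner[of x x] by (simp add: power2_eq_square)
  then show ?thesis
    by (simp add: gauss_def exp_sum[symmetric] sum_divide_distrib sum_negf)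
qed

text \<open>Lebesgue measure on a Euclidean space is the image of a product of one-dimensional Lebesgue
  measures, so that functions that factor over the coordinates can be integrated factor by factor.\<close>

lemma lborel_integral_prod:
  fixes h :: "'a::euclidean_space \<Rightarrow> real \<Rightarrow> 'b::{real_normed_field, banach, second_countable_topology}"
  assumes int: "\<And>b. b \<in> Basis \<Longrightarrow> integrable lborel (h b)"
  shows "integrable lborel (\<lambda>x. \<Prod>b\<in>Basis. h b (x \<bullet> b))" (is ?int)
    and "(\<integral>x. (\<Prod>b\<in>Basis. h b (x \<bullet> b)) \<partial>lborel) = (\<Prod>b\<in>Basis. \<integral>s. h b s \<partial>lborel)" (is ?eq)
proof -
  interpret product_sigma_finite "\<lambda>_::'a. lborel :: real measure" ..
  have [measurable]: "h b \<in> borel_measurable borel" if "b \<in> Basis" for b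
    using borel_measurable_integrable[OF int[OF that]] by simp
  have [measurable]: "(\<lambda>x. \<Prod>b\<in>Basis. h b (x \<bullet> b)) \<in> borel_measurable borel"
    by measurable
  have coord: "(\<Prod>b\<in>Basis. h b ((\<Sum>b'\<in>Basis. y b' *\<^sub>R b') \<bullet> b)) = (\<Prod>b\<in>Basis. h b (y b))"
    for y :: "'a \<Rightarrow> real"
    by (intro prod.cong) simp_all
  show ?int
    by (subst lborel_eq) (simp add: integrable_distr_eq coord product_integrable_prod int)
  show ?eq
    by (subst lborel_eq) (simp add: integral_distr coord product_integral_prod int)
qed

lemma integrable_gauss: "integrable lborel (gauss :: 'a::euclidean_space \<Rightarrow> real)"
  unfolding gauss_eq_prod[abs_def, where 'a='a]
  by (rule lborel_integral_prod) (rule integrable_gauss_real)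

lemma fourier_gauss:
  "fourier (\<lambda>x. complex_of_real (gauss x)) \<xi>
     = complex_of_real (sqrt (2 * pi) ^ DIM('a) * gauss (\<xi> :: 'a::euclidean_space))"
proof -
  let ?h = "\<lambda>b s. complex_of_real (gauss s) * exp (- (\<i> * complex_of_real ((\<xi> \<bullet> b) * s)))"
  have "(\<Prod>b\<in>Basis. ?h b (x \<bullet> b)) = complex_of_real (gauss x) * exp (- (\<i> * complex_of_real (\<xi> \<bullet> x)))"
    for x
    by (simp add: gauss_eq_prod[of x] euclidean_inner[of \<xi> x] prod.distrib sum_distrib_left
        sum_negf[symmetric] exp_sum)
  moreover have "integrable lborel (?h b)" for b
    using integrable_fourier_kernel[of "\<lambda>s. complex_of_real (gauss s)" "\<xi> \<bullet> b"] integrable_gauss_real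
    by simp
  ultimately have "fourier (\<lambda>x. complex_of_real (gauss x)) \<xi> = (\<Prod>b\<in>Basis. \<integral>s. ?h b s \<partial>lborel)"
    using lborel_integral_prod(2)[of ?h] by (simp add: fourier_eq_lborel)
  then show ?thesis
    by (simp only: fourier_gauss_real) (simp add: gauss_eq_prod[of \<xi>] prod.distrib)
qed

lemma integral_gauss: "(\<integral>x. gauss (x :: 'a::euclidean_space) \<partial>lborel) = sqrt (2 * pi) ^ DIM('a)"
proof -
  have "complex_of_real (\<integral>x. gauss (x :: 'a) \<partial>lborel) = fourier (\<lambda>x::'a. complex_of_real (gauss x)) 0"
    by (simp add: fourier_eq_lborel)
  also have "\<dots> = complex_of_real (sqrt (2 * pi) ^ DIM('a))"
    unfolding fourier_gauss by (simp add: gauss_def)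
  finally show ?thesis
    by (simp only: of_real_eq_iff)
qed

lemma integrable_gauss_scaled:
  assumes "c \<noteq> 0"
  shows "integrable lborel (\<lambda>x::'a::euclidean_space. gauss (c *\<^sub>R x))"
  using lborel_integrable_affine_iff[of gauss c "0::'a"] assms integrable_gauss by simp

lemma fourier_gauss_scaled:
  fixes \<xi> :: "'a::euclidean_space"
  assumes "c > 0"
  shows "complex_of_real (c ^ DIM('a)) * fourier (\<lambda>x. complex_of_real (gauss (c *\<^sub>R x))) \<xi>
     = complex_of_real (sqrt (2 * pi) ^ DIM('a) * gauss (\<xi> /\<^sub>R c))"
proof -
  have "(\<xi> /\<^sub>R c) \<bullet> (c *\<^sub>R x) = \<xi> \<bullet> x" for x
    using assms by simp
  then show ?thesis
    using lborel_integral_affine[of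
        "\<lambda>x. complex_of_real (gauss x) * exp (- (\<i> * complex_of_real ((\<xi> /\<^sub>R c) \<bullet> x)))" c 0]
      fourier_gauss[of "\<xi> /\<^sub>R c"] assms
    by (simp add: fourier_eq_lborel scaleR_conv_of_real del: inner_scaleR_left inner_scaleR_right)
qed


section \<open>Autocorrelation\<close>

definition autocorrelation :: "('a::euclidean_space \<Rightarrow> complex) \<Rightarrow> 'a \<Rightarrow> complex" where
  "autocorrelation f z = (\<integral>x. f x * cnj (f (x - z)) \<partial>lborel)"

lemma integrable_pair_autocorrelation:
  fixes f :: "'a::euclidean_space \<Rightarrow> complex"
  assumes f: "integrable lborel f"
  shows "integrable (lborel \<Otimes>\<^sub>M lborel) (\<lambda>(x, z). f x * cnj (f (x - z)))"
proof (rule lborel_pair.Fubini_integrable)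
  note [measurable] = borel_measurable_integrable[OF f]
  show "(\<lambda>(x, z). f x * cnj (f (x - z))) \<in> borel_measurable (lborel \<Otimes>\<^sub>M lborel)"
    by measurable
  show "integrable lborel (\<lambda>x. \<integral>z. norm (case (x, z) of (x, z) \<Rightarrow> f x * cnj (f (x - z))) \<partial>lborel)"
    using lborel_integral_translate_reflect[of "\<lambda>x. norm (f x)"] f
    by (simp add: norm_mult)
  show "AE x in lborel. integrable lborel (\<lambda>z. case (x, z) of (x, z) \<Rightarrow> f x * cnj (f (x - z)))"
    using lborel_integrable_translate_reflect[OF f] by simp
qed

lemma integrable_autocorrelation:
  assumes "integrable lborel f"
  shows "integrable lborel (autocorrelation f)"
  unfolding autocorrelation_def[abs_def]
  by (rule lborel_pair.integrable_snd[OF integrable_pair_autocorrelation[OF assms]])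

lemma integral_autocorrelation:
  assumes f: "integrable lborel f"
  shows "(\<integral>z. autocorrelation f z \<partial>lborel) = (\<integral>x. f x \<partial>lborel) * cnj (\<integral>x. f x \<partial>lborel)"
proof -
  note [measurable] = borel_measurable_integrable[OF f]
  have "(\<integral>z. autocorrelation f z \<partial>lborel) = (\<integral>x. (\<integral>z. f x * cnj (f (x - z)) \<partial>lborel) \<partial>lborel)"
    unfolding autocorrelation_def
    by (rule lborel_pair.Fubini_integral[OF integrable_pair_autocorrelation[OF f]])
  also have "\<dots> = (\<integral>x. f x * cnj (\<integral>z. f z \<partial>lborel) \<partial>lborel)"
    using lborel_integral_translate_reflect[of f] by simp
  finally show ?thesis by simp
qed

text \<open>Modulating \<open>f\<close> by the character \<open>exp (- (\<i> * (\<xi> \<bullet> x)))\<close> modulates its autocorrelation by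
  the same character; hence the claim is \<open>integral_autocorrelation\<close> for the modulated function.\<close>

lemma fourier_autocorrelation:
  assumes f: "integrable lborel f"
  shows "fourier (autocorrelation f) \<xi> = complex_of_real ((norm (fourier f \<xi>))\<^sup>2)"
proof -
  note [measurable] = borel_measurable_integrable[OF f]
    borel_measurable_integrable[OF integrable_autocorrelation[OF f]]
  define g where "g x = f x * exp (- (\<i> * complex_of_real (\<xi> \<bullet> x)))" for x
  have g: "integrable lborel g"
    unfolding g_def by (rule integrable_fourier_kernel[OF f])
  have "g x * cnj (g (x - z)) = f x * cnj (f (x - z)) * exp (- (\<i> * complex_of_real (\<xi> \<bullet> z)))" for x z
    by (simp add: g_def exp_cnj mult_ac inner_diff_right exp_add[symmetric] algebra_simps)
  then have "autocorrelation g z = autocorrelation f z * exp (- (\<i> * complex_of_real (\<xi> \<bullet> z)))" for z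
    by (simp add: autocorrelation_def)
  then have "fourier (autocorrelation f) \<xi> = (\<integral>z. autocorrelation g z \<partial>lborel)"
    by (simp add: fourier_eq_lborel)
  also have "\<dots> = fourier f \<xi> * cnj (fourier f \<xi>)"
    using integral_autocorrelation[OF g] by (simp add: fourier_eq_lborel g_def)
  finally show ?thesis
    by (simp only: complex_norm_square)
qed

lemma autocorrelation_0: "autocorrelation f 0 = complex_of_real (\<integral>x. (norm (f x))\<^sup>2 \<partial>lborel)"
  by (simp add: autocorrelation_def complex_norm_square[symmetric] del: of_real_power)

lemma norm_mult_cnj_le:
  "norm (z * cnj w) \<le> (norm z)\<^sup>2 / 2 + (norm w)\<^sup>2 / 2"
  using sum_squares_bound[of "norm z" "norm w"] by (simp add: norm_mult)

text \<open>By the inequality \<open>2 * a * b \<le> a^2 + b^2\<close> and translation invariance; the bound is the value at 0.\<close>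

lemma norm_autocorrelation_le:
  assumes [measurable]: "f \<in> borel_measurable borel" and f: "integrable lborel (\<lambda>x. (norm (f x))\<^sup>2)"
  shows "norm (autocorrelation f z) \<le> (\<integral>x. (norm (f x))\<^sup>2 \<partial>lborel)"
proof -
  have f': "integrable lborel (\<lambda>x. (norm (f (x - z)))\<^sup>2)"
    by (rule lborel_integrable_translate[OF f])
  have "norm (autocorrelation f z) \<le> (\<integral>x. norm (f x * cnj (f (x - z))) \<partial>lborel)"
    unfolding autocorrelation_def by (rule integral_norm_bound)
  also have "\<dots> \<le> (\<integral>x. (norm (f x))\<^sup>2 / 2 + (norm (f (x - z)))\<^sup>2 / 2 \<partial>lborel)"
    using f f' norm_mult_cnj_le by (intro integral_mono_AE' AE_I2) auto
  also have "\<dots> = (\<integral>x. (norm (f x))\<^sup>2 \<partial>lborel)"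
    using f f' lborel_integral_translate[of "\<lambda>x. (norm (f x))\<^sup>2" z] by simp
  finally show ?thesis .
qed

text \<open>The multiplication formula for the autocorrelation and a dilated Gaussian, followed by the
  substitution \<open>z = c w\<close>.  Its right-hand side shows the behaviour for \<open>c \<longlonglongrightarrow> 0\<close>: the
  autocorrelation is evaluated closer and closer to 0, against a fixed Gaussian.\<close>

lemma integral_fourier_square_gauss:
  fixes f :: "'a::euclidean_space \<Rightarrow> complex"
  assumes f: "integrable lborel f" and c: "c > 0"
  shows "complex_of_real (\<integral>\<xi>. (norm (fourier f \<xi>))\<^sup>2 * gauss (c *\<^sub>R \<xi>) \<partial>lborel)
     = complex_of_real (sqrt (2 * pi) ^ DIM('a)) *
         (\<integral>w. autocorrelation f (c *\<^sub>R w) * complex_of_real (gauss w) \<partial>lborel)"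
proof -
  let ?\<phi> = "autocorrelation f" and ?g = "\<lambda>x::'a. complex_of_real (gauss (c *\<^sub>R x))"
  note \<phi> = integrable_autocorrelation[OF f]
  note [measurable] = borel_measurable_integrable[OF \<phi>]
  have ghat: "fourier ?g z = complex_of_real (sqrt (2 * pi) ^ DIM('a) / c ^ DIM('a) * gauss (z /\<^sub>R c))" for z
    using fourier_gauss_scaled[OF c, of z] c by (simp add: field_simps)
  have "complex_of_real (\<integral>\<xi>. (norm (fourier f \<xi>))\<^sup>2 * gauss (c *\<^sub>R \<xi>) \<partial>lborel)
      = (\<integral>\<xi>. fourier ?\<phi> \<xi> * ?g \<xi> \<partial>lborel)"
    by (simp add: fourier_autocorrelation[OF f] del: of_real_power flip: integral_complex_of_real of_real_mult)
  also have "\<dots> = (\<integral>z. ?\<phi> z * fourier ?g z \<partial>lborel)"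
    using \<phi> c integrable_gauss_scaled[of c] by (intro fourier_multiplication_formula) auto
  also have "\<dots> = c ^ DIM('a) *\<^sub>R (\<integral>w. ?\<phi> (c *\<^sub>R w) * fourier ?g (c *\<^sub>R w) \<partial>lborel)"
    using lborel_integral_affine[of "\<lambda>z. ?\<phi> z * fourier ?g z" c 0] c by simp
  also have "\<dots> = c ^ DIM('a) *\<^sub>R (\<integral>w. complex_of_real (sqrt (2 * pi) ^ DIM('a) / c ^ DIM('a)) *
       (?\<phi> (c *\<^sub>R w) * complex_of_real (gauss w)) \<partial>lborel)"
    using c by (simp add: ghat mult_ac)
  also have "\<dots> = complex_of_real (sqrt (2 * pi) ^ DIM('a)) *
         (\<integral>w. ?\<phi> (c *\<^sub>R w) * complex_of_real (gauss w) \<partial>lborel)"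
    using c by (simp only: integral_mult_right_zero) (simp add: scaleR_conv_of_real)
  finally show ?thesis .
qed

lemma sqrt_2pi_power_mult: "sqrt (2 * pi) ^ n * sqrt (2 * pi) ^ n = (2 * pi) ^ n"
  unfolding power_mult_distrib[symmetric, of "sqrt (2 * pi)"] by simp

lemma integrable_fourier_square_gauss:
  fixes f :: "'a::euclidean_space \<Rightarrow> complex"
  assumes f: "integrable lborel f" and c: "c > 0"
  shows "integrable lborel (\<lambda>\<xi>. (norm (fourier f \<xi>))\<^sup>2 * gauss (c *\<^sub>R \<xi>))"
proof (rule Bochner_Integration.integrable_bound)
  note [measurable] = borel_measurable_integrable[OF f]
  let ?M = "(\<integral>x. norm (f x) \<partial>lborel)\<^sup>2"
  show "integrable lborel (\<lambda>\<xi>::'a. ?M * gauss (c *\<^sub>R \<xi>))"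
    using integrable_gauss_scaled[of c] c by auto
  show "AE \<xi> in lborel. norm ((norm (fourier f \<xi>))\<^sup>2 * gauss (c *\<^sub>R \<xi>)) \<le> norm (?M * gauss (c *\<^sub>R \<xi>))"
    using norm_fourier_le[OF f]
    by (auto intro!: AE_I2 mult_mono power_mono simp: abs_mult)
qed (use borel_measurable_integrable[OF f] in measurable)

lemma integral_fourier_square_gauss_le:
  fixes f :: "'a::euclidean_space \<Rightarrow> complex"
  assumes f: "integrable lborel f" and f2: "integrable lborel (\<lambda>x. (norm (f x))\<^sup>2)" and c: "c > 0"
  shows "(\<integral>\<xi>. (norm (fourier f \<xi>))\<^sup>2 * gauss (c *\<^sub>R \<xi>) \<partial>lborel)
     \<le> (2 * pi) ^ DIM('a) * (\<integral>x. (norm (f x))\<^sup>2 \<partial>lborel)" (is "?I \<le> _ * ?M")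
proof -
  note [measurable] = borel_measurable_integrable[OF f]
  have "?I \<le> norm (complex_of_real ?I)"
    by simp
  also have "\<dots> = sqrt (2 * pi) ^ DIM('a) *
      norm (\<integral>w. autocorrelation f (c *\<^sub>R w) * complex_of_real (gauss w) \<partial>lborel)"
    unfolding integral_fourier_square_gauss[OF f c] by (simp add: norm_mult norm_power)
  also have "\<dots> \<le> sqrt (2 * pi) ^ DIM('a) * (\<integral>w. ?M * gauss (w :: 'a) \<partial>lborel)"
  proof (intro mult_left_mono order_trans[OF integral_norm_bound] integral_mono_AE' AE_I2)
    show "norm (autocorrelation f (c *\<^sub>R w) * complex_of_real (gauss w)) \<le> ?M * gauss w" for w
      using norm_autocorrelation_le[OF _ f2, of "c *\<^sub>R w"]
      by (simp add: norm_mult mult_right_mono)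
  qed (auto intro!: integrable_gauss mult_nonneg_nonneg)
  also have "\<dots> = sqrt (2 * pi) ^ DIM('a) * (?M * sqrt (2 * pi) ^ DIM('a))"
    by (simp only: integral_mult_right_zero integral_gauss)
  also have "\<dots> = (2 * pi) ^ DIM('a) * ?M"
    unfolding sqrt_2pi_power_mult[symmetric] by (simp only: mult_ac)
  finally show ?thesis .
qed

lemma gauss_tendsto_1:
  "(\<lambda>k. gauss ((1 / real (Suc k)) *\<^sub>R \<xi>)) \<longlonglongrightarrow> 1"
proof -
  have "(\<lambda>k. gauss ((1 / real (Suc k)) *\<^sub>R \<xi>)) \<longlonglongrightarrow> gauss (0 *\<^sub>R \<xi>)"
    unfolding gauss_def by (intro tendsto_intros LIMSEQ_Suc[OF lim_1_over_n]) auto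
  then show ?thesis by (simp add: gauss_def)
qed

section \<open>The norm inequality\<close>

text \<open>Fatou's lemma for \<open>integral_fourier_square_gauss_le\<close>, along \<open>c = 1 / (k + 1)\<close>.\<close>

lemma fourier_square_integrable_lborel:
  fixes f :: "'a::euclidean_space \<Rightarrow> complex"
  assumes f: "integrable lborel f" and f2: "integrable lborel (\<lambda>x. (norm (f x))\<^sup>2)"
  shows "integrable lborel (\<lambda>\<xi>. (norm (fourier f \<xi>))\<^sup>2)" (is ?int)
    and "(\<integral>\<xi>. (norm (fourier f \<xi>))\<^sup>2 \<partial>lborel) \<le> (2 * pi) ^ DIM('a) * (\<integral>x. (norm (f x))\<^sup>2 \<partial>lborel)" (is ?le)
proof -
  note [measurable] = borel_measurable_integrable[OF f]
  let ?C = "(2 * pi) ^ DIM('a) * (\<integral>x. (norm (f x))\<^sup>2 \<partial>lborel)"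
  let ?u = "\<lambda>k \<xi>. (norm (fourier f \<xi>))\<^sup>2 * gauss ((1 / real (Suc k)) *\<^sub>R \<xi>)"
  have C: "?C \<ge> 0" by simp
  have lim: "(\<lambda>k. ?u k \<xi>) \<longlonglongrightarrow> (norm (fourier f \<xi>))\<^sup>2" for \<xi>
    using tendsto_mult[OF tendsto_const gauss_tendsto_1] by simp
  have le: "(\<integral>\<^sup>+\<xi>. ennreal (?u k \<xi>) \<partial>lborel) \<le> ennreal ?C" for k
    using integral_fourier_square_gauss_le[OF f f2, of "1 / real (Suc k)"]
      integrable_fourier_square_gauss[OF f, of "1 / real (Suc k)"]
    by (subst nn_integral_eq_integral) (auto intro!: ennreal_leI mult_nonneg_nonneg)
  have "(\<integral>\<^sup>+\<xi>. ennreal ((norm (fourier f \<xi>))\<^sup>2) \<partial>lborel)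
      = (\<integral>\<^sup>+\<xi>. liminf (\<lambda>k. ennreal (?u k \<xi>)) \<partial>lborel)"
    by (intro nn_integral_cong lim_imp_Liminf[symmetric] tendsto_ennrealI lim) simp
  also have "\<dots> \<le> liminf (\<lambda>k. \<integral>\<^sup>+\<xi>. ennreal (?u k \<xi>) \<partial>lborel)"
    by (rule nn_integral_liminf) measurable
  also have "\<dots> \<le> ennreal ?C"
    using le by (intro Liminf_le) auto
  finally have *: "(\<integral>\<^sup>+\<xi>. ennreal ((norm (fourier f \<xi>))\<^sup>2) \<partial>lborel) \<le> ennreal ?C" .
  then have "(\<integral>\<^sup>+\<xi>. ennreal ((norm (fourier f \<xi>))\<^sup>2) \<partial>lborel) < \<infinity>"
    by (rule order.strict_trans1) simp
  then show int: ?int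
    by (intro integrableI_bounded) auto
  show ?le
    using * nn_integral_eq_integral[OF int] C by simp
qed


section \<open>Continuity of translation and the norm identity for bounded functions\<close>

definition L1_translation_continuous :: "('a::euclidean_space \<Rightarrow> complex) \<Rightarrow> bool" where
  "L1_translation_continuous f \<longleftrightarrow> integrable lborel f \<and>
     (\<forall>z. z \<longlonglongrightarrow> 0 \<longrightarrow> (\<lambda>k::nat. \<integral>x. norm (f (x - z k) - f x) \<partial>lborel) \<longlonglongrightarrow> 0)"

lemma L1_translation_continuous_approx:
  assumes f: "integrable lborel f"
    and approx: "\<And>e. e > 0 \<Longrightarrow> \<exists>g. L1_translation_continuous g \<and> (\<integral>x. norm (f x - g x) \<partial>lborel) < e"
  shows "L1_translation_continuous f"
  unfolding L1_translation_continuous_def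
proof (intro conjI allI impI f)
  fix z :: "nat \<Rightarrow> 'a" assume z: "z \<longlonglongrightarrow> 0"
  show "(\<lambda>k. \<integral>x. norm (f (x - z k) - f x) \<partial>lborel) \<longlonglongrightarrow> 0"
  proof (rule LIMSEQ_I)
    fix e :: real assume "e > 0"
    then obtain g where g: "L1_translation_continuous g" and fg: "(\<integral>x. norm (f x - g x) \<partial>lborel) < e / 3"
      using approx[of "e / 3"] by auto
    have gi: "integrable lborel g"
      using g by (simp add: L1_translation_continuous_def)
    note [measurable] = borel_measurable_integrable[OF f] borel_measurable_integrable[OF gi]
    note [intro, simp] = f gi lborel_integrable_translate[OF f] lborel_integrable_translate[OF gi]
    have bound: "(\<integral>x. norm (f (x - t) - f x) \<partial>lborel) < (\<integral>x. norm (g (x - t) - g x) \<partial>lborel) + 2 * (e / 3)" for t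
    proof -
      have "(\<integral>x. norm (f (x - t) - f x) \<partial>lborel)
          \<le> (\<integral>x. norm (g (x - t) - g x) + (norm (f (x - t) - g (x - t)) + norm (f x - g x)) \<partial>lborel)"
        by (intro integral_mono) (auto, norm)
      also have "\<dots> = (\<integral>x. norm (g (x - t) - g x) \<partial>lborel) + 2 * (\<integral>x. norm (f x - g x) \<partial>lborel)"
        using lborel_integral_translate[of "\<lambda>x. norm (f x - g x)" t] by simp
      finally show ?thesis using fg by simp
    qed
    obtain K where "\<And>k. k \<ge> K \<Longrightarrow> norm ((\<integral>x. norm (g (x - z k) - g x) \<partial>lborel) - 0) < e / 3"
      using g z \<open>e > 0\<close> LIMSEQ_D[of "\<lambda>k. \<integral>x. norm (g (x - z k) - g x) \<partial>lborel" 0 "e / 3"]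
      by (auto simp: L1_translation_continuous_def)
    then have "norm ((\<integral>x. norm (f (x - z k) - f x) \<partial>lborel) - 0) < e" if "k \<ge> K" for k
      using bound[of "z k"] that by fastforce
    then show "\<exists>K. \<forall>k\<ge>K. norm ((\<integral>x. norm (f (x - z k) - f x) \<partial>lborel) - 0) < e"
      by blast
  qed
qed

text \<open>For an open set \<open>U\<close>, a point of \<open>U\<close> stays in \<open>U\<close> after a small translation.  Thus
  the measure of the intersection of \<open>U\<close> with its translates converges to that of \<open>U\<close>, whatever
  the boundary of \<open>U\<close> may be, and the measure of the symmetric difference converges to 0.\<close>

lemma L1_translation_continuous_open:
  fixes U :: "'a::euclidean_space set"
  assumes U: "open U" and fin: "emeasure lborel U < \<infinity>"
  shows "L1_translation_continuous (\<lambda>x. indicator U x *\<^sub>R c)"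
  unfolding L1_translation_continuous_def
proof (intro conjI allI impI)
  have [measurable]: "U \<in> sets borel" using U by simp
  let ?I = "indicator U :: 'a \<Rightarrow> real"
  have int: "integrable lborel ?I" using fin by simp
  note int' = lborel_integrable_translate[OF int]
  show "integrable lborel (\<lambda>x. indicator U x *\<^sub>R c)" using int by simp
  fix z :: "nat \<Rightarrow> 'a" assume z: "z \<longlonglongrightarrow> 0"
  have int2: "integrable lborel (\<lambda>x. ?I x * ?I (x - t))" for t
    by (rule Bochner_Integration.integrable_bound[OF int]) (auto simp: indicator_def)
  have lim: "(\<lambda>k. \<integral>x. ?I x * ?I (x - z k) \<partial>lborel) \<longlonglongrightarrow> (\<integral>x. ?I x \<partial>lborel)"
  proof (rule integral_dominated_convergence[where w = ?I])
    show "AE x in lborel. (\<lambda>k. ?I x * ?I (x - z k)) \<longlonglongrightarrow> ?I x"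
    proof (intro AE_I2)
      fix x
      show "(\<lambda>k. ?I x * ?I (x - z k)) \<longlonglongrightarrow> ?I x"
      proof (cases "x \<in> U")
        case True
        have "(\<lambda>k. x - z k) \<longlonglongrightarrow> x - 0" by (intro tendsto_intros z)
        then have "\<forall>\<^sub>F k in sequentially. x - z k \<in> U"
          using U True by (auto dest: topological_tendstoD)
        then have "\<forall>\<^sub>F k in sequentially. ?I x * ?I (x - z k) = ?I x"
          by eventually_elim (simp add: True)
        then show ?thesis by (rule tendsto_eventually)
      qed simp
    qed
  qed (use int in \<open>auto simp: indicator_def\<close>)
  have "(\<integral>x. norm (?I (x - t) *\<^sub>R c - ?I x *\<^sub>R c) \<partial>lborel)
      = norm c * (2 * (\<integral>x. ?I x \<partial>lborel) - 2 * (\<integral>x. ?I x * ?I (x - t) \<partial>lborel))" for t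
  proof -
    have "(\<integral>x. norm (?I (x - t) *\<^sub>R c - ?I x *\<^sub>R c) \<partial>lborel)
        = (\<integral>x. norm c * (?I (x - t) + ?I x - 2 * (?I x * ?I (x - t))) \<partial>lborel)"
      by (intro Bochner_Integration.integral_cong) (auto simp: indicator_def)
    then show ?thesis
      using int int2[of t] int'[of t] lborel_integral_translate[of ?I t] by simp
  qed
  moreover have "(\<lambda>k. norm c * (2 * (\<integral>x. ?I x \<partial>lborel) - 2 * (\<integral>x. ?I x * ?I (x - z k) \<partial>lborel)))
      \<longlonglongrightarrow> norm c * (2 * (\<integral>x. ?I x \<partial>lborel) - 2 * (\<integral>x. ?I x \<partial>lborel))"
    by (intro tendsto_intros lim)
  ultimately show "(\<lambda>k. \<integral>x. norm (?I (x - z k) *\<^sub>R c - ?I x *\<^sub>R c) \<partial>lborel) \<longlonglongrightarrow> 0"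
    by simp
qed

text \<open>The property is closed under sums and under limits in \<open>L1\<close>.  Outer regularity reduces indicators
  of measurable sets to indicators of open sets.\<close>

lemma integrable_L1_translation_continuous:
  fixes f :: "'a::euclidean_space \<Rightarrow> complex"
  assumes "integrable lborel f"
  shows "L1_translation_continuous f"
  using assms
proof (induction rule: integrable_induct)
  case (base A c)
  then have A [measurable]: "A \<in> sets borel" and fin: "emeasure lborel A < \<infinity>" by auto
  show ?case
  proof (rule L1_translation_continuous_approx)
    show "integrable lborel (\<lambda>x. indicator A x *\<^sub>R c)" using fin by simp
    fix e :: real assume e: "e > 0"
    \<comment> \<open>An error \<open>d\<close> in measure costs \<open>norm c * d < e\<close>; the 1 covers the case \<open>c = 0\<close>.\<close>
    define d where "d = e / (norm c + 1)"
    have d: "d > 0" using e by (simp add: d_def add_nonneg_pos)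
    obtain U where U: "open U" "A \<subseteq> U" "emeasure lborel (U - A) < d"
      using outer_regular_lborel[OF A d] by auto
    have [measurable]: "U \<in> sets borel" using U by simp
    have "emeasure lborel U = emeasure lborel A + emeasure lborel (U - A)"
      using U by (subst plus_emeasure) (auto simp: Un_absorb1)
    then have finU: "emeasure lborel U < \<infinity>"
      using fin U(3) by (auto simp: ennreal_add_eq_top less_top[symmetric])
    have finD: "emeasure lborel (U - A) < \<infinity>"
      using U(3) by (auto simp: less_top[symmetric])
    have "(\<integral>x. norm (indicator A x *\<^sub>R c - indicator U x *\<^sub>R c) \<partial>lborel)
        = (\<integral>x. norm c * indicator (U - A) x \<partial>lborel)"
      using U by (intro Bochner_Integration.integral_cong) (auto simp: indicator_def)
    also have "\<dots> = norm c * measure lborel (U - A)"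
      using finD by simp
    also have "\<dots> \<le> norm c * d"
      using U(3) d by (intro mult_left_mono) (auto simp: measure_def enn2real_leI)
    also have "\<dots> < (norm c + 1) * d"
      using d by simp
    also have "\<dots> = e"
      using add_nonneg_pos[OF norm_ge_zero zero_less_one, of c] by (simp add: d_def)
    finally show "\<exists>g. L1_translation_continuous g \<and> (\<integral>x. norm (indicator A x *\<^sub>R c - g x) \<partial>lborel) < e"
      using L1_translation_continuous_open[OF U(1) finU, of c] by blast
  qed
next
  case (add f g)
  note [intro, simp] = add.hyps lborel_integrable_translate[OF add.hyps(1)] lborel_integrable_translate[OF add.hyps(2)]
  show ?case
    unfolding L1_translation_continuous_def
  proof (intro conjI allI impI)
    fix z :: "nat \<Rightarrow> 'a" assume z: "z \<longlonglongrightarrow> 0"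
    have "(\<lambda>k. (\<integral>x. norm (f (x - z k) - f x) \<partial>lborel) + (\<integral>x. norm (g (x - z k) - g x) \<partial>lborel)) \<longlonglongrightarrow> 0"
      using add.IH z by (intro tendsto_add_zero) (auto simp: L1_translation_continuous_def)
    moreover have "norm (\<integral>x. norm (f (x - z k) + g (x - z k) - (f x + g x)) \<partial>lborel)
          \<le> (\<integral>x. norm (f (x - z k) - f x) \<partial>lborel) + (\<integral>x. norm (g (x - z k) - g x) \<partial>lborel)" for k
    proof -
      have "(\<integral>x. norm (f (x - z k) + g (x - z k) - (f x + g x)) \<partial>lborel)
            \<le> (\<integral>x. norm (f (x - z k) - f x) + norm (g (x - z k) - g x) \<partial>lborel)"
        by (intro integral_mono) (auto, norm)
      then show ?thesis by simp
    qed
    ultimately show "(\<lambda>k. \<integral>x. norm (f (x - z k) + g (x - z k) - (f x + g x)) \<partial>lborel) \<longlonglongrightarrow> 0"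
      by (rule Lim_null_comparison[rotated, OF _ always_eventually, OF _ allI])
  qed simp
next
  case (lim f s)
  note [measurable] = borel_measurable_integrable[OF lim.hyps(4)] borel_measurable_integrable[OF lim.hyps(1)]
  show ?case
  proof (rule L1_translation_continuous_approx[OF lim.hyps(4)])
    fix e :: real assume e: "e > 0"
    have "(\<lambda>i. \<integral>x. norm (f x - s i x) \<partial>lborel) \<longlonglongrightarrow> (\<integral>x. 0 \<partial>(lborel :: 'a measure))"
    proof (rule integral_dominated_convergence[where w = "\<lambda>x. 3 * norm (f x)"])
      show "AE x in lborel. (\<lambda>i. norm (f x - s i x)) \<longlonglongrightarrow> 0"
      proof (intro AE_I2)
        fix x
        have "(\<lambda>i. norm (f x - s i x)) \<longlonglongrightarrow> norm (f x - f x)"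
          by (intro tendsto_intros lim.hyps) simp
        then show "(\<lambda>i. norm (f x - s i x)) \<longlonglongrightarrow> 0" by simp
      qed
      show "AE x in lborel. norm (norm (f x - s i x)) \<le> 3 * norm (f x)" for i
      proof (intro AE_I2)
        fix x
        show "norm (norm (f x - s i x)) \<le> 3 * norm (f x)"
          using lim.hyps(3)[of x i] norm_triangle_ineq4[of "f x" "s i x"] by simp
      qed
      show "integrable lborel (\<lambda>x. 3 * norm (f x))"
        by (intro integrable_mult_right integrable_norm lim.hyps(4))
    qed measurable
    then obtain i where "norm (\<integral>x. norm (f x - s i x) \<partial>lborel) < e"
      using e LIMSEQ_D[of "\<lambda>i. \<integral>x. norm (f x - s i x) \<partial>lborel" 0 e] by auto
    then show "\<exists>g. L1_translation_continuous g \<and> (\<integral>x. norm (f x - g x) \<partial>lborel) < e"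
      using lim.IH[of i] by (intro exI[of _ "s i"]) simp
  qed
qed

text \<open>For \<open>f\<close> bounded by \<open>B\<close>, the difference of the autocorrelation at \<open>z\<close> and at 0 is
  at most \<open>B\<close> times the \<open>L1\<close> distance of \<open>f\<close> and its translate.\<close>

lemma autocorrelation_tendsto:
  fixes f :: "'a::euclidean_space \<Rightarrow> complex"
  assumes f: "integrable lborel f" and B: "\<And>x. norm (f x) \<le> B" and z: "z \<longlonglongrightarrow> 0"
  shows "(\<lambda>k::nat. autocorrelation f (z k)) \<longlonglongrightarrow> autocorrelation f 0"
proof (rule LIM_zero_cancel, rule Lim_null_comparison[OF always_eventually])
  note [measurable] = borel_measurable_integrable[OF f]
  have f': "integrable lborel (\<lambda>x. f (x - t))" for t
    by (rule lborel_integrable_translate[OF f])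
  have int: "integrable lborel (\<lambda>x. f x * cnj (f (x - t)))" for t
  proof (rule Bochner_Integration.integrable_bound)
    show "integrable lborel (\<lambda>x. B * norm (f (x - t)))" using f' by auto
    show "AE x in lborel. norm (f x * cnj (f (x - t))) \<le> norm (B * norm (f (x - t)))"
      using order_trans[OF B abs_ge_self] by (auto simp: norm_mult abs_mult intro!: AE_I2 mult_right_mono)
  qed measurable
  show "\<forall>k. norm (autocorrelation f (z k) - autocorrelation f 0)
      \<le> B * (\<integral>x. norm (f (x - z k) - f x) \<partial>lborel)"
  proof
    fix k
    have "autocorrelation f (z k) - autocorrelation f 0 = (\<integral>x. f x * cnj (f (x - z k) - f x) \<partial>lborel)"
      using int[of "z k"] int[of 0] by (simp add: autocorrelation_def right_diff_distrib)
    also have "norm \<dots> \<le> (\<integral>x. norm (f x * cnj (f (x - z k) - f x)) \<partial>lborel)"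
      by (rule integral_norm_bound)
    also have "\<dots> \<le> (\<integral>x. B * norm (f (x - z k) - f x) \<partial>lborel)"
      using f f' B order_trans[OF norm_ge_zero B] by (intro integral_mono_AE' AE_I2) (auto simp: norm_mult complex_mod_cnj intro!: mult_right_mono simp del: complex_cnj_diff)
    finally show "norm (autocorrelation f (z k) - autocorrelation f 0)
      \<le> B * (\<integral>x. norm (f (x - z k) - f x) \<partial>lborel)" by simp
  qed
  show "(\<lambda>k. B * (\<integral>x. norm (f (x - z k) - f x) \<partial>lborel)) \<longlonglongrightarrow> 0"
    using integrable_L1_translation_continuous[OF f] z
    by (auto simp: L1_translation_continuous_def intro!: tendsto_mult_right_zero)
qed

text \<open>Both sides of \<open>integral_fourier_square_gauss\<close> converge for \<open>c \<longlonglongrightarrow> 0\<close> by dominated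
  convergence; on the left this uses that \<open>|fourier f|^2\<close> is already known to be integrable.\<close>

lemma plancherel_bounded_lborel:
  fixes f :: "'a::euclidean_space \<Rightarrow> complex"
  assumes f: "integrable lborel f" and f2: "integrable lborel (\<lambda>x. (norm (f x))\<^sup>2)"
    and B: "\<And>x. norm (f x) \<le> B"
  shows "(\<integral>\<xi>. (norm (fourier f \<xi>))\<^sup>2 \<partial>lborel) = (2 * pi) ^ DIM('a) * (\<integral>x. (norm (f x))\<^sup>2 \<partial>lborel)"
proof -
  note [measurable] = borel_measurable_integrable[OF f]
    borel_measurable_integrable[OF integrable_autocorrelation[OF f]]
  let ?c = "\<lambda>k. 1 / real (Suc k)"
  let ?M = "\<integral>x. (norm (f x))\<^sup>2 \<partial>lborel"
  have M: "?M \<ge> 0" by simp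
  have "(\<lambda>k. \<integral>\<xi>. (norm (fourier f \<xi>))\<^sup>2 * gauss (?c k *\<^sub>R \<xi>) \<partial>lborel)
      \<longlonglongrightarrow> (\<integral>\<xi>. (norm (fourier f \<xi>))\<^sup>2 \<partial>lborel)"
  proof (rule integral_dominated_convergence[where w = "\<lambda>\<xi>. (norm (fourier f \<xi>))\<^sup>2"])
    show "AE \<xi> in lborel. (\<lambda>k. (norm (fourier f \<xi>))\<^sup>2 * gauss (?c k *\<^sub>R \<xi>)) \<longlonglongrightarrow> (norm (fourier f \<xi>))\<^sup>2"
      using tendsto_mult[OF tendsto_const gauss_tendsto_1] by (intro AE_I2) simp
    show "AE \<xi> in lborel. norm ((norm (fourier f \<xi>))\<^sup>2 * gauss (?c k *\<^sub>R \<xi>)) \<le> (norm (fourier f \<xi>))\<^sup>2" for k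
      by (auto simp: abs_mult intro!: AE_I2 mult_left_le)
  qed (use fourier_square_integrable_lborel(1)[OF f f2] in measurable)
  then have 1: "(\<lambda>k. complex_of_real (\<integral>\<xi>. (norm (fourier f \<xi>))\<^sup>2 * gauss (?c k *\<^sub>R \<xi>) \<partial>lborel))
      \<longlonglongrightarrow> complex_of_real (\<integral>\<xi>. (norm (fourier f \<xi>))\<^sup>2 \<partial>lborel)"
    by (rule tendsto_of_real)
  have "(\<lambda>k. \<integral>w. autocorrelation f (?c k *\<^sub>R w) * complex_of_real (gauss w) \<partial>lborel)
      \<longlonglongrightarrow> (\<integral>w. autocorrelation f 0 * complex_of_real (gauss (w :: 'a)) \<partial>lborel)"
  proof (rule integral_dominated_convergence[where w = "\<lambda>w. ?M * gauss w"])
    show "AE w in lborel. (\<lambda>k. autocorrelation f (?c k *\<^sub>R w) * complex_of_real (gauss w))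
        \<longlonglongrightarrow> autocorrelation f 0 * complex_of_real (gauss w)"
    proof (intro AE_I2 tendsto_mult tendsto_const autocorrelation_tendsto[OF f B])
      show "(\<lambda>k. ?c k *\<^sub>R w) \<longlonglongrightarrow> 0" for w :: 'a
        using tendsto_scaleR[OF LIMSEQ_Suc[OF lim_1_over_n] tendsto_const[of w]] by simp
    qed
    show "AE w in lborel. norm (autocorrelation f (?c k *\<^sub>R w) * complex_of_real (gauss w)) \<le> ?M * gauss w" for k
      using norm_autocorrelation_le[OF _ f2]
      by (auto simp: norm_mult intro!: AE_I2 mult_right_mono)
  qed (use integrable_gauss in auto)
  also have "(\<integral>w. autocorrelation f 0 * complex_of_real (gauss (w :: 'a)) \<partial>lborel)
      = complex_of_real (?M * sqrt (2 * pi) ^ DIM('a))"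
    by (simp add: autocorrelation_0 integral_gauss del: of_real_power)
  finally have "(\<lambda>k. complex_of_real (sqrt (2 * pi) ^ DIM('a)) *
      (\<integral>w. autocorrelation f (?c k *\<^sub>R w) * complex_of_real (gauss w) \<partial>lborel))
      \<longlonglongrightarrow> complex_of_real (sqrt (2 * pi) ^ DIM('a)) * complex_of_real (?M * sqrt (2 * pi) ^ DIM('a))"
    by (intro tendsto_mult tendsto_const)
  also have "complex_of_real (sqrt (2 * pi) ^ DIM('a)) * complex_of_real (?M * sqrt (2 * pi) ^ DIM('a))
      = complex_of_real ((2 * pi) ^ DIM('a) * ?M)"
    unfolding sqrt_2pi_power_mult[symmetric] of_real_mult by (simp only: mult_ac)
  finally have 2: "(\<lambda>k. complex_of_real (\<integral>\<xi>. (norm (fourier f \<xi>))\<^sup>2 * gauss (?c k *\<^sub>R \<xi>) \<partial>lborel))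
      \<longlonglongrightarrow> complex_of_real ((2 * pi) ^ DIM('a) * ?M)"
    using integral_fourier_square_gauss[OF f, of "?c _"] by simp
  show ?thesis
    using LIMSEQ_unique[OF 1 2] by (simp only: of_real_eq_iff)
qed


section \<open>Completeness of \<open>L2\<close>\<close>

lemma L2_cases:
  fixes F :: "'a::euclidean_space L2"
  obtains f where "square_integrable f" "F = abs_L2 f"
  by (induction F rule: L2.abs_induct) auto

lemma norm_abs_L2:
  assumes "square_integrable f"
  shows "norm (abs_L2 f) = sqrt (\<integral>x. (norm (f x))\<^sup>2 \<partial>lebesgue)"
  using assms by (intro norm_L2.abs_eq) auto

lemma abs_L2_add:
  "square_integrable f \<Longrightarrow> square_integrable g \<Longrightarrow> abs_L2 f + abs_L2 g = abs_L2 (\<lambda>x. f x + g x)"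
  by (intro plus_L2.abs_eq) auto

lemma L2_scaleC_abs:
  "square_integrable f \<Longrightarrow> L2_scaleC c (abs_L2 f) = abs_L2 (\<lambda>x. c * f x)"
  by (intro L2_scaleC.abs_eq) auto

lemma L2_reflect_abs:
  "square_integrable f \<Longrightarrow> L2_reflect (abs_L2 f) = abs_L2 (\<lambda>x. f (- x))"
  by (intro L2_reflect.abs_eq) auto

lemma L2_inner_abs:
  "square_integrable f \<Longrightarrow> square_integrable g \<Longrightarrow>
    L2_inner (abs_L2 f) (abs_L2 g) = (\<integral>x. f x * cnj (g x) \<partial>lebesgue)"
  by (intro L2_inner.abs_eq) auto

lemma square_integrable_diff:
  assumes "square_integrable f" "square_integrable g"
  shows "square_integrable (\<lambda>x. f x - g x)"
  using square_integrable_add[OF assms(1) square_integrable_cmult[OF assms(2), of "- 1"]] by simp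

lemma abs_L2_diff:
  assumes "square_integrable f" "square_integrable g"
  shows "abs_L2 f - abs_L2 g = abs_L2 (\<lambda>x. f x - g x)"
  using assms abs_L2_add[of "\<lambda>x. f x - g x" g] square_integrable_diff[OF assms]
  by (simp add: algebra_simps)

lemma square_integrable_bound:
  assumes f: "square_integrable f" and [measurable]: "g \<in> borel_measurable lebesgue"
    and le: "AE x in lebesgue. norm (g x) \<le> norm (f x)"
  shows "square_integrable g"
  unfolding square_integrable_def
proof
  show "integrable lebesgue (\<lambda>x. (norm (g x))\<^sup>2)"
    by (rule Bochner_Integration.integrable_bound[OF square_integrable_integrable[OF f]])
       (use le in \<open>auto intro: power_mono\<close>)
qed measurable

lemma abs_L2_tendsto_dominated:
  fixes f :: "'a::euclidean_space \<Rightarrow> complex"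
  assumes f: "square_integrable f" and s: "\<And>k. s k \<in> borel_measurable lebesgue"
    and lim: "AE x in lebesgue. (\<lambda>k. s k x) \<longlonglongrightarrow> f x"
    and le: "\<And>k. AE x in lebesgue. norm (s k x) \<le> norm (f x)"
  shows "(\<lambda>k. abs_L2 (s k)) \<longlonglongrightarrow> abs_L2 f"
proof -
  note [measurable] = square_integrable_measurable[OF f] s
  have ss: "square_integrable (s k)" for k
    using f s le by (rule square_integrable_bound)
  have "(\<lambda>k. \<integral>x. (norm (s k x - f x))\<^sup>2 \<partial>lebesgue) \<longlonglongrightarrow> (\<integral>x. 0 \<partial>(lebesgue :: 'a measure))"
  proof (rule integral_dominated_convergence[where w = "\<lambda>x. 4 * (norm (f x))\<^sup>2"])
    show "AE x in lebesgue. (\<lambda>k. (norm (s k x - f x))\<^sup>2) \<longlonglongrightarrow> 0"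
      using lim
    proof eventually_elim
      case (elim x)
      have "(\<lambda>k. (norm (s k x - f x))\<^sup>2) \<longlonglongrightarrow> (norm (f x - f x))\<^sup>2"
        by (intro tendsto_intros elim)
      then show ?case by simp
    qed
    show "AE x in lebesgue. norm ((norm (s k x - f x))\<^sup>2) \<le> 4 * (norm (f x))\<^sup>2" for k
      using le[of k]
    proof eventually_elim
      case (elim x)
      have "norm (s k x - f x) \<le> 2 * norm (f x)"
        using norm_triangle_ineq4[of "s k x" "f x"] elim by simp
      then have "(norm (s k x - f x))\<^sup>2 \<le> (2 * norm (f x))\<^sup>2"
        by (intro power_mono) auto
      then show ?case by (simp add: power_mult_distrib)
    qed
  qed (use square_integrable_integrable[OF f] in \<open>auto\<close>)
  then have "(\<lambda>k. sqrt (\<integral>x. (norm (s k x - f x))\<^sup>2 \<partial>lebesgue)) \<longlonglongrightarrow> sqrt 0"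
    by (intro tendsto_real_sqrt) simp
  then have "(\<lambda>k. norm (abs_L2 (s k) - abs_L2 f)) \<longlonglongrightarrow> 0"
    using ss f by (simp add: abs_L2_diff norm_abs_L2 square_integrable_diff)
  then show ?thesis
    using LIM_zero_cancel tendsto_norm_zero_iff by blast
qed

text \<open>Fatou's lemma in terms of norms.  It is used with \<open>s k\<close> a difference of two members of a Cauchy
  sequence, where it yields both that the pointwise limit is square-integrable and how close it is.\<close>

lemma square_integrable_fatou:
  fixes s :: "nat \<Rightarrow> 'a::euclidean_space \<Rightarrow> complex"
  assumes s: "\<And>k. square_integrable (s k)" and [measurable]: "f \<in> borel_measurable lebesgue"
    and lim: "AE x in lebesgue. (\<lambda>k. s k x) \<longlonglongrightarrow> f x"
    and le: "\<forall>\<^sub>F k in sequentially. norm (abs_L2 (s k)) \<le> e"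
  shows "square_integrable f" and "norm (abs_L2 f) \<le> e"
proof -
  note [measurable] = square_integrable_measurable[OF s]
  have e: "e \<ge> 0"
    using eventually_happens[OF le] by (auto intro: order_trans[OF norm_ge_zero])
  have norm_s: "(\<integral>\<^sup>+x. ennreal ((norm (s k x))\<^sup>2) \<partial>lebesgue) = ennreal ((norm (abs_L2 (s k)))\<^sup>2)" for k
    using square_integrable_integrable[OF s] by (simp add: nn_integral_eq_integral norm_abs_L2 s)
  have "(\<integral>\<^sup>+x. ennreal ((norm (f x))\<^sup>2) \<partial>lebesgue)
      = (\<integral>\<^sup>+x. liminf (\<lambda>k. ennreal ((norm (s k x))\<^sup>2)) \<partial>lebesgue)"
  proof (rule nn_integral_cong_AE)
    show "AE x in lebesgue. ennreal ((norm (f x))\<^sup>2) = liminf (\<lambda>k. ennreal ((norm (s k x))\<^sup>2))"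
      using lim by eventually_elim (auto intro!: lim_imp_Liminf[symmetric] tendsto_intros)
  qed
  also have "\<dots> \<le> liminf (\<lambda>k. \<integral>\<^sup>+x. ennreal ((norm (s k x))\<^sup>2) \<partial>lebesgue)"
    by (rule nn_integral_liminf) measurable
  also have "\<dots> \<le> ennreal (e\<^sup>2)"
    unfolding norm_s
    using le by (intro Liminf_le) (auto elim!: eventually_mono intro!: ennreal_leI power_mono)
  finally have *: "(\<integral>\<^sup>+x. ennreal ((norm (f x))\<^sup>2) \<partial>lebesgue) \<le> ennreal (e\<^sup>2)" .
  then have "(\<integral>\<^sup>+x. ennreal ((norm (f x))\<^sup>2) \<partial>lebesgue) < \<infinity>"
    by (rule order.strict_trans1) simp
  then have int: "integrable lebesgue (\<lambda>x. (norm (f x))\<^sup>2)"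
    by (intro integrableI_bounded) auto
  then show f: "square_integrable f"
    by (simp add: square_integrable_def)
  have "(\<integral>x. (norm (f x))\<^sup>2 \<partial>lebesgue) \<le> e\<^sup>2"
    using * nn_integral_eq_integral[OF int] by simp
  then show "norm (abs_L2 f) \<le> e"
    using e by (simp add: norm_abs_L2[OF f] real_le_lsqrt)
qed

text \<open>Let \<open>d k = |s (Suc k) x - s k x|\<close>.  The weighted sum of \<open>2^k * (d k)^2\<close> has finite
  integral, so it is finite almost everywhere.  It controls the sum of \<open>d k\<close> because
  \<open>d k \<le> (1/2)^k + 2^k * (d k)^2\<close>.\<close>

lemma AE_convergent_of_fast_Cauchy:
  fixes s :: "nat \<Rightarrow> 'a::euclidean_space \<Rightarrow> complex"
  assumes s: "\<And>k. square_integrable (s k)"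
    and fast: "\<And>k. norm (abs_L2 (s (Suc k)) - abs_L2 (s k)) \<le> (1 / 2) ^ k"
  shows "AE x in lebesgue. convergent (\<lambda>k. s k x)"
proof -
  note [measurable] = square_integrable_measurable[OF s]
  let ?d = "\<lambda>k x. s (Suc k) x - s k x"
  have d: "square_integrable (?d k)" for k
    by (intro square_integrable_diff s)
  have le: "(\<integral>\<^sup>+x. ennreal (2 ^ k * (norm (?d k x))\<^sup>2) \<partial>lebesgue) \<le> ennreal ((1 / 2) ^ k)" for k
  proof -
    have "(\<integral>\<^sup>+x. ennreal (2 ^ k * (norm (?d k x))\<^sup>2) \<partial>lebesgue)
        = ennreal (2 ^ k * (\<integral>x. (norm (?d k x))\<^sup>2 \<partial>lebesgue))"
      using square_integrable_integrable[OF d] by (subst nn_integral_eq_integral) auto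
    also have "(\<integral>x. (norm (?d k x))\<^sup>2 \<partial>lebesgue) = (norm (abs_L2 (s (Suc k)) - abs_L2 (s k)))\<^sup>2"
      by (simp add: abs_L2_diff s norm_abs_L2[OF d])
    also have "ennreal (2 ^ k * \<dots>) \<le> ennreal (2 ^ k * ((1 / 2) ^ k)\<^sup>2)"
      by (intro ennreal_leI mult_left_mono power_mono fast) auto
    also have "(2::real) ^ k * ((1 / 2) ^ k)\<^sup>2 = (1 / 2) ^ k"
      by (simp add: power2_eq_square power_divide)
    finally show ?thesis .
  qed
  have "(\<integral>\<^sup>+x. (\<Sum>k. ennreal (2 ^ k * (norm (?d k x))\<^sup>2)) \<partial>lebesgue)
      = (\<Sum>k. \<integral>\<^sup>+x. ennreal (2 ^ k * (norm (?d k x))\<^sup>2) \<partial>lebesgue)"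
    by (rule nn_integral_suminf) measurable
  also have "\<dots> \<le> (\<Sum>k. ennreal ((1 / 2) ^ k))"
    by (intro suminf_le le) auto
  also have "\<dots> = ennreal (\<Sum>k. (1 / 2) ^ k)"
    by (intro suminf_ennreal2 summable_geometric) auto
  finally have "(\<integral>\<^sup>+x. (\<Sum>k. ennreal (2 ^ k * (norm (?d k x))\<^sup>2)) \<partial>lebesgue) \<noteq> \<infinity>"
    by (auto simp: top_unique)
  then have "AE x in lebesgue. (\<Sum>k. ennreal (2 ^ k * (norm (?d k x))\<^sup>2)) \<noteq> \<infinity>"
    by (intro nn_integral_noteq_infinite) auto
  then show ?thesis
  proof eventually_elim
    case (elim x)
    then have sm: "summable (\<lambda>k. 2 ^ k * (norm (?d k x))\<^sup>2)"
      by (intro summable_suminf_not_top) auto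
    have "summable (\<lambda>k. ?d k x)"
    proof (rule summable_comparison_test')
      show "summable (\<lambda>k. (1 / 2) ^ k + 2 ^ k * (norm (?d k x))\<^sup>2)"
        by (intro summable_add sm summable_geometric) auto
      show "norm (?d k x) \<le> (1 / 2) ^ k + 2 ^ k * (norm (?d k x))\<^sup>2" for k
      proof -
        have "0 \<le> (1 - 2 ^ k * norm (?d k x))\<^sup>2 + 2 ^ k * norm (?d k x)" by simp
        also have "\<dots> = 2 ^ k * ((1 / 2) ^ k + 2 ^ k * (norm (?d k x))\<^sup>2 - norm (?d k x))"
          by (simp add: power2_eq_square algebra_simps power_divide)
        finally have "2 ^ k * 0 \<le> 2 ^ k * ((1 / 2) ^ k + 2 ^ k * (norm (?d k x))\<^sup>2 - norm (?d k x))"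
          by simp
        then have "0 \<le> (1 / 2) ^ k + 2 ^ k * (norm (?d k x))\<^sup>2 - norm (?d k x)"
          by (rule mult_left_le_imp_le) simp
        then show ?thesis by simp
      qed
    qed
    then have "convergent (\<lambda>n. \<Sum>k<n. ?d k x)"
      by (simp add: summable_iff_convergent)
    then have "convergent (\<lambda>n. s n x - s 0 x)"
      by (simp only: sum_lessThan_telescope[of "\<lambda>k. s k x"])
    then show ?case
      using convergent_add[OF _ convergent_const[of "s 0 x"]] by fastforce
  qed
qed

text \<open>The Riesz--Fischer theorem: a subsequence with geometrically decreasing distances converges
  almost everywhere, and by Fatou's lemma its pointwise limit is also its limit in norm.\<close>

instance L2 :: (euclidean_space) banach
proof
  fix X :: "nat \<Rightarrow> 'a L2" assume X: "Cauchy X"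
  have "\<forall>k. \<exists>N. \<forall>m\<ge>N. \<forall>n\<ge>N. norm (X m - X n) < (1 / 2) ^ k"
    using X by (simp add: Cauchy_iff)
  then obtain N where N: "\<And>k m n. m \<ge> N k \<Longrightarrow> n \<ge> N k \<Longrightarrow> norm (X m - X n) < (1 / 2) ^ k"
    by metis
  \<comment> \<open>A strictly increasing sequence above \<open>N\<close>: partial sums dominate each term, and adding \<open>k\<close> makes them strict.\<close>
  define r where "r k = (\<Sum>j\<le>k. N j) + k" for k
  have r_mono: "strict_mono r"
    by (auto simp: strict_mono_Suc_iff r_def)
  have r_ge: "N k \<le> r k" for k
    using member_le_sum[of k "{..k}" N] by (simp add: r_def)
  have "\<exists>f. square_integrable f \<and> X n = abs_L2 f" for n
    by (rule L2_cases[of "X n"]) auto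
  then obtain x where x: "\<And>n. square_integrable (x n)" "\<And>n. X n = abs_L2 (x n)"
    by metis
  define s where "s k = x (r k)" for k
  have s: "square_integrable (s k)" for k
    by (simp add: s_def x)
  have Xs: "X (r k) = abs_L2 (s k)" for k
    by (simp add: s_def x)
  note [measurable] = square_integrable_measurable[OF s]
  have tail: "norm (abs_L2 (s m) - abs_L2 (s k)) \<le> (1 / 2) ^ k" if "m \<ge> k" for k m
    using N[of k "r m" "r k"] r_ge[of k] strict_mono_mono[OF r_mono] that
    unfolding Xs[symmetric] by (meson less_imp_le monoD order_trans)
  have conv: "AE t in lebesgue. convergent (\<lambda>k. s k t)"
    by (rule AE_convergent_of_fast_Cauchy[OF s tail]) simp
  define f where "f t = lim (\<lambda>k. s k t)" for t
  have [measurable]: "f \<in> borel_measurable lebesgue"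
    unfolding f_def[abs_def] by measurable
  have lim: "AE t in lebesgue. (\<lambda>k. s k t) \<longlonglongrightarrow> f t"
    using conv by eventually_elim (simp add: f_def convergent_LIMSEQ_iff)
  have close: "square_integrable (\<lambda>t. f t - s k t)" "norm (abs_L2 (\<lambda>t. f t - s k t)) \<le> (1 / 2) ^ k" for k
  proof -
    have "AE t in lebesgue. (\<lambda>m. s m t - s k t) \<longlonglongrightarrow> f t - s k t"
      using lim by eventually_elim (intro tendsto_intros)
    moreover have "\<forall>\<^sub>F m in sequentially. norm (abs_L2 (\<lambda>t. s m t - s k t)) \<le> (1 / 2) ^ k"
      using eventually_ge_at_top[of k] by eventually_elim (use tail in \<open>simp add: abs_L2_diff s\<close>)
    moreover have "square_integrable (\<lambda>t. s m t - s k t)" for m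
      by (intro square_integrable_diff s)
    ultimately show "square_integrable (\<lambda>t. f t - s k t)" "norm (abs_L2 (\<lambda>t. f t - s k t)) \<le> (1 / 2) ^ k"
      using square_integrable_fatou[of "\<lambda>m t. s m t - s k t" "\<lambda>t. f t - s k t" "(1 / 2) ^ k"] by simp_all
  qed
  have f: "square_integrable f"
    using square_integrable_add[OF close(1)[of 0] s[of 0]] by simp
  have "(\<lambda>k. X (r k)) \<longlonglongrightarrow> abs_L2 f"
  proof (rule LIM_zero_cancel, rule Lim_null_comparison[OF always_eventually])
    show "\<forall>k. norm (X (r k) - abs_L2 f) \<le> (1 / 2) ^ k"
    proof
      fix k
      have "norm (X (r k) - abs_L2 f) = norm (abs_L2 f - abs_L2 (s k))"
        unfolding Xs by (rule norm_minus_commute)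
      then show "norm (X (r k) - abs_L2 f) \<le> (1 / 2) ^ k"
        using close(2)[of k] by (simp add: abs_L2_diff f s)
    qed
    show "(\<lambda>k. (1 / 2 :: real) ^ k) \<longlonglongrightarrow> 0"
      by (intro LIMSEQ_realpow_zero) auto
  qed
  then have "X \<longlonglongrightarrow> abs_L2 f"
    using Cauchy_converges_subseq[OF X r_mono] by (simp add: o_def)
  then show "convergent X"
    by (auto simp: convergent_def)
qed


section \<open>The transform on square-integrable integrable functions\<close>

lemma borel_representative:
  fixes f :: "'a::euclidean_space \<Rightarrow> complex"
  assumes f: "f \<in> borel_measurable lebesgue"
  obtains g where "g \<in> borel_measurable borel" "AE x in lebesgue. f x = g x"
proof -
  have re: "(\<lambda>x. Re (f x)) \<in> borel_measurable lebesgue" and im: "(\<lambda>x. Im (f x)) \<in> borel_measurable lebesgue"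
    using f by measurable
  obtain u where [measurable]: "u \<in> borel_measurable lborel" and u: "AE x in lborel. Re (f x) = u x"
    using completion_ex_borel_measurable_real[OF re] by blast
  obtain v where [measurable]: "v \<in> borel_measurable lborel" and v: "AE x in lborel. Im (f x) = v x"
    using completion_ex_borel_measurable_real[OF im] by blast
  have "AE x in lebesgue. f x = Complex (u x) (v x)"
    using AE_completion[OF u] AE_completion[OF v] by eventually_elim (simp add: complex_eq_iff)
  moreover have "(\<lambda>x. Complex (u x) (v x)) \<in> borel_measurable lborel"
    unfolding Complex_eq by measurable
  ultimately show thesis by (intro that) simp_all
qed

lemma fourier_kernel_measurable_lebesgue [measurable]:
  "(\<lambda>x. exp (- (\<i> * complex_of_real (\<xi> \<bullet> x)))) \<in> borel_measurable lebesgue"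
  by (rule measurable_completion) measurable

lemma fourier_cong_AE:
  fixes f g :: "'a::euclidean_space \<Rightarrow> complex"
  assumes [measurable]: "f \<in> borel_measurable lebesgue" "g \<in> borel_measurable lebesgue"
    and ae: "AE x in lebesgue. f x = g x"
  shows "fourier f = fourier g"
proof
  fix \<xi>
  show "fourier f \<xi> = fourier g \<xi>"
    unfolding fourier_def
    by (rule integral_cong_AE) (use ae in \<open>auto elim: AE_mp\<close>)
qed

lemma integrable_fourier_kernel_lebesgue:
  fixes f :: "'a::euclidean_space \<Rightarrow> complex"
  assumes f: "integrable lebesgue f"
  shows "integrable lebesgue (\<lambda>x. f x * exp (- (\<i> * complex_of_real (\<xi> \<bullet> x))))"
proof (rule Bochner_Integration.integrable_bound[OF f])
  note [measurable] = borel_measurable_integrable[OF f]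
  show "(\<lambda>x. f x * exp (- (\<i> * complex_of_real (\<xi> \<bullet> x)))) \<in> borel_measurable lebesgue"
    by measurable
qed (simp add: norm_mult)

lemma fourier_add:
  assumes "integrable lebesgue f" "integrable lebesgue g"
  shows "fourier (\<lambda>x. f x + g x) = (\<lambda>\<xi>. fourier f \<xi> + fourier g \<xi>)"
  using assms[THEN integrable_fourier_kernel_lebesgue] by (simp add: fourier_def fun_eq_iff distrib_right)

lemma fourier_diff:
  assumes "integrable lebesgue f" "integrable lebesgue g"
  shows "fourier (\<lambda>x. f x - g x) = (\<lambda>\<xi>. fourier f \<xi> - fourier g \<xi>)"
  using assms[THEN integrable_fourier_kernel_lebesgue] by (simp add: fourier_def fun_eq_iff left_diff_distrib)

lemma fourier_cmult: "fourier (\<lambda>x. c * f x) = (\<lambda>\<xi>. c * fourier f \<xi>)"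
  by (simp add: fourier_def fun_eq_iff mult.assoc)

lemma cnj_fourier_uminus: "cnj (fourier f (- \<xi>)) = fourier (\<lambda>x. cnj (f x)) \<xi>"
proof -
  have "cnj (fourier f (- \<xi>)) = (\<integral>x. cnj (f x * exp (- (\<i> * complex_of_real ((- \<xi>) \<bullet> x)))) \<partial>lebesgue)"
    unfolding fourier_def by (rule Bochner_Integration.integral_cnj[symmetric])
  then show ?thesis by (simp add: fourier_def exp_cnj)
qed

lemma borel_representative_L1_L2:
  fixes f :: "'a::euclidean_space \<Rightarrow> complex"
  assumes f1: "integrable lebesgue f" and f2: "square_integrable f"
  obtains g where "integrable lborel g" "integrable lborel (\<lambda>x. (norm (g x))\<^sup>2)"
    "AE x in lebesgue. f x = g x" "fourier f = fourier g"
    "(\<integral>x. (norm (f x))\<^sup>2 \<partial>lebesgue) = (\<integral>x. (norm (g x))\<^sup>2 \<partial>lborel)"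
proof -
  note f [measurable] = square_integrable_measurable[OF f2]
  obtain g where g [measurable]: "g \<in> borel_measurable borel" and ae: "AE x in lebesgue. f x = g x"
    using borel_representative[OF f] by blast
  have g' [measurable]: "g \<in> borel_measurable lebesgue"
    using g by (intro measurable_completion) simp
  have ae2: "AE x in lebesgue. (norm (f x))\<^sup>2 = (norm (g x))\<^sup>2"
    using ae by eventually_elim simp
  have g2: "(\<lambda>x. (norm (g x))\<^sup>2) \<in> borel_measurable lborel" by measurable
  show thesis
  proof
    have "integrable lebesgue g"
      using f1 integrable_cong_AE[OF f g' ae] by simp
    then show "integrable lborel g"
      by (simp add: integrable_completion)
    have "integrable lebesgue (\<lambda>x. (norm (g x))\<^sup>2)"
      using square_integrable_integrable[OF f2] integrable_cong_AE[OF _ _ ae2] by simp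
    then show "integrable lborel (\<lambda>x. (norm (g x))\<^sup>2)"
      using integrable_completion[OF g2] by simp
    show "fourier f = fourier g"
      by (rule fourier_cong_AE[OF f g' ae])
    show "(\<integral>x. (norm (f x))\<^sup>2 \<partial>lebesgue) = (\<integral>x. (norm (g x))\<^sup>2 \<partial>lborel)"
      using integral_cong_AE[OF _ _ ae2] integral_completion[OF g2] by simp
  qed fact
qed

definition plancherel_constant :: "'a::euclidean_space itself \<Rightarrow> real" where
  "plancherel_constant _ = sqrt ((2 * pi) ^ DIM('a))"

lemma plancherel_constant_pos: "plancherel_constant TYPE('a::euclidean_space) > 0"
  by (simp add: plancherel_constant_def)

lemma plancherel_constant_square:
  "(plancherel_constant TYPE('a::euclidean_space))\<^sup>2 = (2 * pi) ^ DIM('a)"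
  by (simp add: plancherel_constant_def)

lemma
  fixes f :: "'a::euclidean_space \<Rightarrow> complex"
  assumes f1: "integrable lebesgue f" and f2: "square_integrable f"
  shows square_integrable_fourier: "square_integrable (fourier f)"
    and norm_abs_L2_fourier_le:
      "norm (abs_L2 (fourier f)) \<le> plancherel_constant TYPE('a) * norm (abs_L2 f)"
proof -
  obtain g where g: "integrable lborel g" "integrable lborel (\<lambda>x. (norm (g x))\<^sup>2)"
    "fourier f = fourier g" "(\<integral>x. (norm (f x))\<^sup>2 \<partial>lebesgue) = (\<integral>x. (norm (g x))\<^sup>2 \<partial>lborel)"
    using borel_representative_L1_L2[OF assms] by blast
  have [measurable]: "fourier g \<in> borel_measurable borel"
    using borel_measurable_integrable[OF g(1)] by (intro fourier_measurable) simp
  have m: "(\<lambda>\<xi>. (norm (fourier g \<xi>))\<^sup>2) \<in> borel_measurable lborel" by measurable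
  show sq: "square_integrable (fourier f)"
    unfolding square_integrable_def g(3)
    using fourier_square_integrable_lborel(1)[OF g(1,2)] integrable_completion[OF m]
    by (auto intro: measurable_completion)
  have "(\<integral>\<xi>. (norm (fourier g \<xi>))\<^sup>2 \<partial>lebesgue) \<le> (2 * pi) ^ DIM('a) * (\<integral>x. (norm (g x))\<^sup>2 \<partial>lborel)"
    using fourier_square_integrable_lborel(2)[OF g(1,2)] integral_completion[OF m] by simp
  then show "norm (abs_L2 (fourier f)) \<le> plancherel_constant TYPE('a) * norm (abs_L2 f)"
    unfolding norm_abs_L2[OF sq] norm_abs_L2[OF f2] plancherel_constant_def real_sqrt_mult[symmetric]
    by (simp add: g)
qed

text \<open>A Borel representative of a bounded function is bounded only almost everywhere; it is
  replaced by 0 where it exceeds the bound.\<close>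

lemma norm_abs_L2_fourier_bounded:
  fixes f :: "'a::euclidean_space \<Rightarrow> complex"
  assumes f1: "integrable lebesgue f" and f2: "square_integrable f" and B: "\<And>x. norm (f x) \<le> B"
  shows "norm (abs_L2 (fourier f)) = plancherel_constant TYPE('a) * norm (abs_L2 f)"
proof -
  obtain g where g: "integrable lborel g" "integrable lborel (\<lambda>x. (norm (g x))\<^sup>2)"
    "AE x in lebesgue. f x = g x"
    "fourier f = fourier g" "(\<integral>x. (norm (f x))\<^sup>2 \<partial>lebesgue) = (\<integral>x. (norm (g x))\<^sup>2 \<partial>lborel)"
    using borel_representative_L1_L2[OF f1 f2] by blast
  note [measurable] = borel_measurable_integrable[OF g(1)]
  have [measurable]: "fourier g \<in> borel_measurable borel"
    by (intro fourier_measurable) simp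
  define h where "h x = (if norm (g x) \<le> B then g x else 0)" for x
  have B0: "0 \<le> B" using order_trans[OF norm_ge_zero B] .
  have [measurable]: "h \<in> borel_measurable lborel" unfolding h_def[abs_def] by measurable
  have "AE x in lebesgue. g x = h x"
    using g(3) by eventually_elim (use B in \<open>auto simp: h_def dest: sym\<close>)
  then have gh: "AE x in lborel. g x = h x"
    by (simp add: AE_completion_iff)
  have gh2: "AE x in lborel. (norm (g x))\<^sup>2 = (norm (h x))\<^sup>2"
    using gh by eventually_elim simp
  have h: "integrable lborel h" "integrable lborel (\<lambda>x. (norm (h x))\<^sup>2)"
    using g(1,2) integrable_cong_AE[OF _ _ gh] integrable_cong_AE[OF _ _ gh2] by simp_all
  have "fourier g = fourier h"
    using gh by (intro fourier_cong_AE measurable_completion AE_completion) simp_all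
  moreover have "(\<integral>x. (norm (g x))\<^sup>2 \<partial>lborel) = (\<integral>x. (norm (h x))\<^sup>2 \<partial>lborel)"
    using gh2 by (intro integral_cong_AE) simp_all
  moreover have "(\<integral>\<xi>. (norm (fourier h \<xi>))\<^sup>2 \<partial>lborel) = (2 * pi) ^ DIM('a) * (\<integral>x. (norm (h x))\<^sup>2 \<partial>lborel)"
    by (rule plancherel_bounded_lborel[OF h, of B]) (simp add: h_def B0)
  moreover have "(\<integral>\<xi>. (norm (fourier g \<xi>))\<^sup>2 \<partial>lebesgue) = (\<integral>\<xi>. (norm (fourier g \<xi>))\<^sup>2 \<partial>lborel)"
    by (rule integral_completion) measurable
  ultimately show ?thesis
    unfolding norm_abs_L2[OF square_integrable_fourier[OF f1 f2]] norm_abs_L2[OF f2]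
      plancherel_constant_def real_sqrt_mult[symmetric]
    by (simp add: g)
qed

lemma abs_L2_fourier_tendsto:
  fixes f :: "'a::euclidean_space \<Rightarrow> complex"
  assumes f: "integrable lebesgue f" "square_integrable f"
    and s: "\<And>k. integrable lebesgue (s k)" "\<And>k. square_integrable (s k)"
    and lim: "(\<lambda>k. abs_L2 (s k)) \<longlonglongrightarrow> abs_L2 f"
  shows "(\<lambda>k. abs_L2 (fourier (s k))) \<longlonglongrightarrow> abs_L2 (fourier f)"
proof (rule LIM_zero_cancel, rule Lim_null_comparison[OF always_eventually])
  show "\<forall>k. norm (abs_L2 (fourier (s k)) - abs_L2 (fourier f))
      \<le> plancherel_constant TYPE('a) * norm (abs_L2 (s k) - abs_L2 f)"
    using norm_abs_L2_fourier_le[OF Bochner_Integration.integrable_diff[OF s(1) f(1)] square_integrable_diff[OF s(2) f(2)]]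
    by (simp add: fourier_diff f s abs_L2_diff square_integrable_fourier)
  show "(\<lambda>k. plancherel_constant TYPE('a) * norm (abs_L2 (s k) - abs_L2 f)) \<longlonglongrightarrow> 0"
    using lim by (intro tendsto_mult_right_zero tendsto_norm_zero) (simp add: LIM_zero)
qed

section \<open>Density of bounded integrable functions\<close>

lemma square_integrable_cutoff:
  assumes f: "square_integrable f" and [measurable]: "A \<in> sets lebesgue"
  shows "square_integrable (\<lambda>x. indicator A x *\<^sub>R f x)"
proof (rule square_integrable_bound[OF f])
  note [measurable] = square_integrable_measurable[OF f]
  show "(\<lambda>x. indicator A x *\<^sub>R f x) \<in> borel_measurable lebesgue" by measurable
qed (auto simp: indicator_def)

text \<open>On a set of finite measure, \<open>|f|\<close> is dominated by \<open>1 + |f|^2\<close>.\<close>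

lemma integrable_cutoff:
  assumes f: "square_integrable f" and A [measurable]: "A \<in> sets lebesgue" and b: "bounded A"
  shows "integrable lebesgue (\<lambda>x. indicator A x *\<^sub>R f x)"
proof (rule Bochner_Integration.integrable_bound)
  note [measurable] = square_integrable_measurable[OF f]
  have "A \<in> lmeasurable" using A b by (rule bounded_set_imp_lmeasurable[rotated])
  then show "integrable lebesgue (\<lambda>x. indicator A x + (norm (f x))\<^sup>2)"
    using square_integrable_integrable[OF f] by (intro Bochner_Integration.integrable_add) (auto simp: fmeasurable_def)
  have "t \<le> 1 + t\<^sup>2" for t :: real
    using zero_le_power2[of "t - 1 / 2"] by (simp add: power2_eq_square algebra_simps)
  then show "AE x in lebesgue. norm (indicator A x *\<^sub>R f x) \<le> norm (indicator A x + (norm (f x))\<^sup>2)"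
    by (intro AE_I2) (simp add: indicator_def)
  show "(\<lambda>x. indicator A x *\<^sub>R f x) \<in> borel_measurable lebesgue" by measurable
qed

lemma cutoff_tendsto:
  assumes f: "square_integrable f" and A [measurable]: "\<And>k::nat. A k \<in> sets lebesgue"
    and ev: "\<And>x. \<forall>\<^sub>F k in sequentially. x \<in> A k"
  shows "(\<lambda>k. abs_L2 (\<lambda>x. indicator (A k) x *\<^sub>R f x)) \<longlonglongrightarrow> abs_L2 f"
proof (rule abs_L2_tendsto_dominated[OF f])
  note [measurable] = square_integrable_measurable[OF f]
  show "(\<lambda>x. indicator (A k) x *\<^sub>R f x) \<in> borel_measurable lebesgue" for k by measurable
  show "AE x in lebesgue. (\<lambda>k. indicator (A k) x *\<^sub>R f x) \<longlonglongrightarrow> f x"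
  proof (intro AE_I2 tendsto_eventually)
    fix x
    show "\<forall>\<^sub>F k in sequentially. indicator (A k) x *\<^sub>R f x = f x"
      using ev[of x] by eventually_elim simp
  qed
qed (auto simp: indicator_def)

lemma eventually_norm_le_nat: "\<forall>\<^sub>F k in sequentially. norm x \<le> real k"
  using eventually_ge_at_top[of "nat \<lceil>norm x\<rceil>"] by eventually_elim linarith

text \<open>Cut off to a ball to gain integrability, and where \<open>f\<close> is large to gain boundedness.\<close>

lemma L2_dense:
  fixes F :: "'a::euclidean_space L2"
  shows "\<exists>s :: nat \<Rightarrow> 'a \<Rightarrow> complex.
    (\<forall>k. integrable lebesgue (s k) \<and> square_integrable (s k) \<and> (\<forall>x. norm (s k x) \<le> real k)) \<and>
    (\<lambda>k. abs_L2 (s k)) \<longlonglongrightarrow> F"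
proof -
  obtain f where f: "square_integrable f" and F: "F = abs_L2 f" by (rule L2_cases)
  note [measurable] = square_integrable_measurable[OF f]
  define A where "A k = cball 0 (real k) \<inter> {x. norm (f x) \<le> real k}" for k :: nat
  have "{x \<in> space lebesgue. norm (f x) \<le> real k} \<in> sets lebesgue" for k by measurable
  then have A: "A k \<in> sets lebesgue" for k
    by (auto simp: A_def)
  show ?thesis
  proof (intro exI[of _ "\<lambda>k x. indicator (A k) x *\<^sub>R f x"] conjI allI)
    show "integrable lebesgue (\<lambda>x. indicator (A k) x *\<^sub>R f x)" for k
      by (rule integrable_cutoff[OF f A]) (auto simp: A_def)
    show "square_integrable (\<lambda>x. indicator (A k) x *\<^sub>R f x)" for k
      by (rule square_integrable_cutoff[OF f A])
    show "norm (indicator (A k) x *\<^sub>R f x) \<le> real k" for k x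
      by (auto simp: indicator_def A_def)
    show "(\<lambda>k. abs_L2 (\<lambda>x. indicator (A k) x *\<^sub>R f x)) \<longlonglongrightarrow> F"
      unfolding F
    proof (rule cutoff_tendsto[OF f A])
      show "\<forall>\<^sub>F k in sequentially. x \<in> A k" for x
        using eventually_norm_le_nat[of x] eventually_norm_le_nat[of "f x"]
        by eventually_elim (simp add: A_def)
    qed
  qed
qed

section \<open>Extension to \<open>L2\<close>\<close>

text \<open>Multiplication by the indicator of a ball is linear and maps square-integrable functions to integrable
  ones; so each truncated transform is a linear operator that is defined on all classes, and the
  extension can be obtained as their pointwise limit.\<close>

lift_definition truncated_fourier :: "nat \<Rightarrow> 'a::euclidean_space L2 \<Rightarrow> 'a L2" is
  "\<lambda>k f. fourier (\<lambda>x. indicator (cball 0 (real k)) x *\<^sub>R f x)"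
proof -
  fix k :: nat and f g :: "'a \<Rightarrow> complex"
  let ?c = "\<lambda>f x. indicator (cball 0 (real k)) x *\<^sub>R f x"
  assume fg: "square_integrable f \<and> square_integrable g \<and> (AE x in lebesgue. f x = g x)"
  then have sq: "square_integrable (?c f)" "square_integrable (?c g)"
    by (auto intro!: square_integrable_cutoff)
  have "AE x in lebesgue. ?c f x = ?c g x"
    using fg by (auto elim: AE_mp)
  then have "fourier (?c f) = fourier (?c g)"
    using sq by (intro fourier_cong_AE) (auto dest: square_integrable_measurable)
  moreover have "square_integrable (fourier (?c f))"
    using fg sq by (intro square_integrable_fourier integrable_cutoff) auto
  ultimately show "square_integrable (fourier (?c f)) \<and> square_integrable (fourier (?c g)) \<and>
      (AE x in lebesgue. fourier (?c f) x = fourier (?c g) x)"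
    by simp
qed

lemma truncated_fourier_abs:
  "square_integrable f \<Longrightarrow> truncated_fourier k (abs_L2 f) =
     abs_L2 (fourier (\<lambda>x. indicator (cball 0 (real k)) x *\<^sub>R f x))"
  by (intro truncated_fourier.abs_eq) auto

lemma truncated_fourier_add:
  "truncated_fourier k (F + G) = truncated_fourier k F + truncated_fourier k G"
proof -
  obtain f g where fg: "square_integrable f" "square_integrable g" and F: "F = abs_L2 f" "G = abs_L2 g"
    by (metis L2_cases)
  show ?thesis
    unfolding F using fg
    by (simp add: abs_L2_add truncated_fourier_abs square_integrable_add square_integrable_cutoff
        square_integrable_fourier integrable_cutoff scaleR_add_right fourier_add)
qed

lemma truncated_fourier_scaleC:
  "truncated_fourier k (L2_scaleC c F) = L2_scaleC c (truncated_fourier k F)"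
proof -
  obtain f where f: "square_integrable f" and F: "F = abs_L2 f" by (rule L2_cases)
  have "fourier (\<lambda>x. indicator (cball 0 (real k)) x *\<^sub>R (c * f x))
      = (\<lambda>\<xi>. c * fourier (\<lambda>x. indicator (cball 0 (real k)) x *\<^sub>R f x) \<xi>)"
    by (simp add: fourier_cmult[symmetric])
  then show ?thesis
    unfolding F using f
    by (simp add: L2_scaleC_abs truncated_fourier_abs square_integrable_cmult square_integrable_cutoff
        square_integrable_fourier integrable_cutoff)
qed

text \<open>By the norm inequality, distances of truncated transforms are bounded by those of the cutoffs,
  which converge.\<close>

lemma truncated_fourier_Cauchy:
  fixes F :: "'a::euclidean_space L2"
  shows "Cauchy (\<lambda>k. truncated_fourier k F)"
proof -
  obtain f where f: "square_integrable f" and F: "F = abs_L2 f" by (rule L2_cases)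
  let ?c = "\<lambda>k x. indicator (cball 0 (real k)) x *\<^sub>R f x"
  let ?C = "plancherel_constant TYPE('a)"
  have c: "integrable lebesgue (?c k)" "square_integrable (?c k)" for k
    using f by (auto intro!: integrable_cutoff square_integrable_cutoff)
  have le: "norm (truncated_fourier m F - truncated_fourier n F) \<le> ?C * norm (abs_L2 (?c m) - abs_L2 (?c n))" for m n
    using norm_abs_L2_fourier_le[OF Bochner_Integration.integrable_diff[OF c(1)[of m] c(1)[of n]] square_integrable_diff[OF c(2)[of m] c(2)[of n]]]
    by (simp add: F truncated_fourier_abs f fourier_diff c abs_L2_diff square_integrable_fourier)
  have "(\<lambda>k. abs_L2 (?c k)) \<longlonglongrightarrow> F"
    unfolding F using f eventually_norm_le_nat by (intro cutoff_tendsto) auto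
  then have Cau: "Cauchy (\<lambda>k. abs_L2 (?c k))"
    by (rule LIMSEQ_imp_Cauchy)
  show ?thesis
  proof (rule CauchyI)
    fix e :: real assume "e > 0"
    then have "e / ?C > 0" using plancherel_constant_pos[where 'a='a] by simp
    then obtain M where M: "\<And>m n. m \<ge> M \<Longrightarrow> n \<ge> M \<Longrightarrow> norm (abs_L2 (?c m) - abs_L2 (?c n)) < e / ?C"
      using CauchyD[OF Cau] by blast
    have "norm (truncated_fourier m F - truncated_fourier n F) < e" if "m \<ge> M" "n \<ge> M" for m n
      using le[of m n] M[OF that] plancherel_constant_pos[where 'a='a]
      by (simp add: pos_less_divide_eq mult.commute)
    then show "\<exists>M. \<forall>m\<ge>M. \<forall>n\<ge>M. norm (truncated_fourier m F - truncated_fourier n F) < e"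
      by blast
  qed
qed

lemma norm_truncated_fourier_le:
  fixes F :: "'a::euclidean_space L2"
  shows "norm (truncated_fourier k F) \<le> plancherel_constant TYPE('a) * norm F"
proof -
  obtain f where f: "square_integrable f" and F: "F = abs_L2 f" by (rule L2_cases)
  let ?c = "\<lambda>x. indicator (cball 0 (real k)) x *\<^sub>R f x"
  have c: "integrable lebesgue ?c" "square_integrable ?c"
    using f by (auto intro!: integrable_cutoff square_integrable_cutoff)
  have "(\<integral>x. (norm (?c x))\<^sup>2 \<partial>lebesgue) \<le> (\<integral>x. (norm (f x))\<^sup>2 \<partial>lebesgue)"
    using square_integrable_integrable[OF f] square_integrable_integrable[OF c(2)]
    by (intro integral_mono) (auto simp: indicator_def)
  then have "norm (abs_L2 ?c) \<le> norm F"
    by (simp add: F norm_abs_L2 f c)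
  then show ?thesis
    using norm_abs_L2_fourier_le[OF c] plancherel_constant_pos[where 'a='a]
    by (simp add: F truncated_fourier_abs f) (meson mult_left_mono less_imp_le order_trans)
qed

lemma bounded_linear_L2_scaleC: "bounded_linear (L2_scaleC c)"
proof (rule bounded_linear_intro)
  fix F G :: "'a L2" and r :: real
  obtain f g where fg: "square_integrable f" "square_integrable g" and F: "F = abs_L2 f" "G = abs_L2 g"
    by (metis L2_cases)
  show "L2_scaleC c (F + G) = L2_scaleC c F + L2_scaleC c G"
    unfolding F using fg
    by (simp add: abs_L2_add L2_scaleC_abs square_integrable_add square_integrable_cmult distrib_left)
  show "L2_scaleC c (r *\<^sub>R F) = r *\<^sub>R L2_scaleC c F"
    unfolding F scaleR_L2_def using fg
    by (simp add: L2_scaleC_abs square_integrable_cmult mult_ac)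
  show "norm (L2_scaleC c F) \<le> norm F * norm c"
    unfolding F using fg
    by (simp add: L2_scaleC_abs square_integrable_cmult norm_abs_L2 norm_mult power_mult_distrib real_sqrt_mult)
qed

definition fourier_extension :: "'a::euclidean_space L2 \<Rightarrow> 'a L2" where
  "fourier_extension F = lim (\<lambda>k. truncated_fourier k F)"

lemma truncated_fourier_tendsto:
  "(\<lambda>k. truncated_fourier k F) \<longlonglongrightarrow> fourier_extension F"
  using truncated_fourier_Cauchy[of F]
  by (simp add: fourier_extension_def Cauchy_convergent_iff convergent_LIMSEQ_iff)

lemma fourier_extension_bounded_clinear:
  "bounded_clinear_L2 (fourier_extension :: 'a::euclidean_space L2 \<Rightarrow> 'a L2)"
proof -
  have scaleC: "fourier_extension (L2_scaleC c F) = L2_scaleC c (fourier_extension F)" for c and F :: "'a L2"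
    using LIMSEQ_unique[OF truncated_fourier_tendsto[of "L2_scaleC c F", unfolded truncated_fourier_scaleC]
        bounded_linear.tendsto[OF bounded_linear_L2_scaleC truncated_fourier_tendsto]] .
  have "bounded_linear (fourier_extension :: 'a L2 \<Rightarrow> 'a L2)"
  proof (rule bounded_linear_intro)
    fix F G :: "'a L2" and r :: real
    show "fourier_extension (F + G) = fourier_extension F + fourier_extension G"
      using LIMSEQ_unique[OF truncated_fourier_tendsto[of "F + G", unfolded truncated_fourier_add]
          tendsto_add[OF truncated_fourier_tendsto truncated_fourier_tendsto]] .
    show "fourier_extension (r *\<^sub>R F) = r *\<^sub>R fourier_extension F"
      by (simp add: scaleR_L2_def scaleC)
    show "norm (fourier_extension F) \<le> norm F * plancherel_constant TYPE('a)"
      by (rule LIMSEQ_le_const2[OF tendsto_norm[OF truncated_fourier_tendsto]])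
         (use norm_truncated_fourier_le in \<open>auto simp: mult.commute\<close>)
  qed
  with scaleC show ?thesis by (simp add: bounded_clinear_L2_def)
qed

lemma fourier_extension_extends:
  "extends_fourier (fourier_extension :: 'a::euclidean_space L2 \<Rightarrow> 'a L2)"
  unfolding extends_fourier_def
proof (intro allI impI conjI; elim conjE)
  fix f :: "'a \<Rightarrow> complex"
  assume f: "integrable lebesgue f" "square_integrable f"
  show "square_integrable (fourier f)"
    by (rule square_integrable_fourier[OF f])
  have "(\<lambda>k. truncated_fourier k (abs_L2 f)) \<longlonglongrightarrow> abs_L2 (fourier f)"
    unfolding truncated_fourier_abs[OF f(2)]
    using f eventually_norm_le_nat
    by (intro abs_L2_fourier_tendsto cutoff_tendsto integrable_cutoff square_integrable_cutoff) auto
  then show "fourier_extension (abs_L2 f) = abs_L2 (fourier f)"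
    by (rule LIMSEQ_unique[OF truncated_fourier_tendsto])
qed

lemma ex1_fourier_L2:
  "\<exists>!F :: 'a::euclidean_space L2 \<Rightarrow> 'a L2. bounded_clinear_L2 F \<and> extends_fourier F"
proof (rule ex1I[of _ fourier_extension])
  show "bounded_clinear_L2 (fourier_extension :: 'a L2 \<Rightarrow> 'a L2) \<and> extends_fourier (fourier_extension :: 'a L2 \<Rightarrow> 'a L2)"
    using fourier_extension_bounded_clinear fourier_extension_extends by blast
  fix T :: "'a L2 \<Rightarrow> 'a L2"
  assume T: "bounded_clinear_L2 T \<and> extends_fourier T"
  show "T = fourier_extension"
  proof
    fix F :: "'a L2"
    obtain s where s: "\<And>k. integrable lebesgue (s k)" "\<And>k. square_integrable (s k)"
        "\<And>k x. norm (s k x) \<le> real k" and lim: "(\<lambda>k. abs_L2 (s k)) \<longlonglongrightarrow> F"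
      using L2_dense[of F] by blast
    have eq: "T (abs_L2 (s k)) = fourier_extension (abs_L2 (s k))" for k
      using T fourier_extension_extends[where 'a='a] s by (simp add: extends_fourier_def)
    have "bounded_linear T" and "bounded_linear (fourier_extension :: 'a L2 \<Rightarrow> 'a L2)"
      using T fourier_extension_bounded_clinear[where 'a='a] by (simp_all add: bounded_clinear_L2_def)
    from this[THEN bounded_linear.tendsto, OF lim] show "T F = fourier_extension F"
      unfolding eq by (rule LIMSEQ_unique)
  qed
qed

lemma
  shows fourier_L2_bounded_clinear: "bounded_clinear_L2 (fourier_L2 :: 'a::euclidean_space L2 \<Rightarrow> 'a L2)"
    and fourier_L2_extends: "extends_fourier (fourier_L2 :: 'a L2 \<Rightarrow> 'a L2)"
  using theI'[OF ex1_fourier_L2[where 'a='a]] by (simp_all add: fourier_L2_def)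

lemma
  shows bounded_linear_fourier_L2: "bounded_linear (fourier_L2 :: 'a::euclidean_space L2 \<Rightarrow> 'a L2)"
    and fourier_L2_scaleC: "fourier_L2 (L2_scaleC c F) = L2_scaleC c (fourier_L2 (F :: 'a L2))"
  using fourier_L2_bounded_clinear[where 'a='a] by (simp_all add: bounded_clinear_L2_def)

lemma fourier_L2_abs:
  fixes f :: "'a::euclidean_space \<Rightarrow> complex"
  shows "integrable lebesgue f \<Longrightarrow> square_integrable f \<Longrightarrow> fourier_L2 (abs_L2 f) = abs_L2 (fourier f)"
  using fourier_L2_extends[where 'a='a] by (simp add: extends_fourier_def)

text \<open>Both sides are continuous, and they agree for the bounded integrable functions, which are dense.\<close>

lemma norm_fourier_L2:
  fixes F :: "'a::euclidean_space L2"
  shows "norm (fourier_L2 F) = plancherel_constant TYPE('a) * norm F"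
proof -
  obtain s where s: "\<And>k. integrable lebesgue (s k)" "\<And>k. square_integrable (s k)"
    "\<And>k x. norm (s k x) \<le> real k" and lim: "(\<lambda>k. abs_L2 (s k)) \<longlonglongrightarrow> F"
    using L2_dense[of F] by blast
  have "(\<lambda>k. norm (fourier_L2 (abs_L2 (s k)))) \<longlonglongrightarrow> norm (fourier_L2 F)"
    by (intro tendsto_norm bounded_linear.tendsto[OF bounded_linear_fourier_L2 lim])
  moreover have "norm (fourier_L2 (abs_L2 (s k))) = plancherel_constant TYPE('a) * norm (abs_L2 (s k))" for k
    using norm_abs_L2_fourier_bounded[OF s] by (simp add: fourier_L2_abs s)
  moreover have "(\<lambda>k. plancherel_constant TYPE('a) * norm (abs_L2 (s k))) \<longlonglongrightarrow> plancherel_constant TYPE('a) * norm F"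
    by (intro tendsto_intros lim)
  ultimately show ?thesis
    using LIMSEQ_unique by simp
qed

section \<open>Inner products\<close>

lemma integrable_mult_cnj:
  assumes f: "square_integrable f" and g: "square_integrable g"
  shows "integrable lebesgue (\<lambda>x. f x * cnj (g x))"
proof (rule Bochner_Integration.integrable_bound)
  note [measurable] = square_integrable_measurable[OF f] square_integrable_measurable[OF g]
  show "integrable lebesgue (\<lambda>x. (norm (f x))\<^sup>2 / 2 + (norm (g x))\<^sup>2 / 2)"
    using square_integrable_integrable[OF f] square_integrable_integrable[OF g] by simp
  show "AE x in lebesgue. norm (f x * cnj (g x)) \<le> norm ((norm (f x))\<^sup>2 / 2 + (norm (g x))\<^sup>2 / 2)"
    using norm_mult_cnj_le by (intro AE_I2) (simp add: order_trans[OF norm_mult_cnj_le])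
  show "(\<lambda>x. f x * cnj (g x)) \<in> borel_measurable lebesgue" by measurable
qed

lemma L2_inner_diff_right: "L2_inner F (G - H) = L2_inner F G - L2_inner F H"
proof -
  obtain f g h where *: "square_integrable f" "square_integrable g" "square_integrable h"
    and F: "F = abs_L2 f" "G = abs_L2 g" "H = abs_L2 h"
    by (metis L2_cases)
  then show ?thesis
    by (simp add: abs_L2_diff L2_inner_abs square_integrable_diff right_diff_distrib integrable_mult_cnj)
qed

lemma L2_inner_scaleR_right: "L2_inner F (r *\<^sub>R G) = complex_of_real r * L2_inner F G"
proof -
  obtain f g where *: "square_integrable f" "square_integrable g"
    and F: "F = abs_L2 f" "G = abs_L2 g"
    by (metis L2_cases)
  have "(\<integral>x. f x * (complex_of_real r * cnj (g x)) \<partial>lebesgue)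
      = complex_of_real r * (\<integral>x. f x * cnj (g x) \<partial>lebesgue)"
    by (simp add: mult.left_commute)
  with * F show ?thesis
    by (simp add: scaleR_L2_def L2_scaleC_abs L2_inner_abs square_integrable_cmult)
qed

lemma L2_inner_commute: "L2_inner F G = cnj (L2_inner G F)"
proof -
  obtain f g where *: "square_integrable f" "square_integrable g"
    and F: "F = abs_L2 f" "G = abs_L2 g"
    by (metis L2_cases)
  then show ?thesis
    by (simp add: L2_inner_abs mult.commute flip: Bochner_Integration.integral_cnj)
qed

lemma L2_inner_self: "L2_inner F F = complex_of_real ((norm F)\<^sup>2)"
proof -
  obtain f where f: "square_integrable f" and F: "F = abs_L2 f" by (rule L2_cases)
  then show ?thesis
    by (simp add: L2_inner_abs norm_abs_L2 complex_norm_square[symmetric] del: of_real_power)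
qed

lemma L2_eq_scaleR_I:
  assumes "\<And>H. L2_inner H F = complex_of_real r * L2_inner H G"
  shows "F = r *\<^sub>R G"
proof -
  have "L2_inner (F - r *\<^sub>R G) (F - r *\<^sub>R G) = 0"
    by (simp add: L2_inner_diff_right[of _ F] L2_inner_scaleR_right assms)
  then show ?thesis
    by (simp add: L2_inner_self)
qed

text \<open>The inner product is expressed by norms, so both its continuity and its behaviour under
  \<open>fourier_L2\<close> follow from the corresponding facts about norms.\<close>

lemma L2_inner_polarization:
  "4 * L2_inner F G = complex_of_real ((norm (F + G))\<^sup>2) - complex_of_real ((norm (F - G))\<^sup>2)
     + \<i> * complex_of_real ((norm (F + L2_scaleC \<i> G))\<^sup>2) - \<i> * complex_of_real ((norm (F - L2_scaleC \<i> G))\<^sup>2)"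
proof -
  obtain f g where fg: "square_integrable f" "square_integrable g"
    and F: "F = abs_L2 f" "G = abs_L2 g"
    by (metis L2_cases)
  have norm: "has_bochner_integral lebesgue (\<lambda>x. complex_of_real ((norm (h x))\<^sup>2)) (complex_of_real ((norm (abs_L2 h))\<^sup>2))"
    if "square_integrable h" for h :: "'a \<Rightarrow> complex"
    using square_integrable_integrable[OF that]
    by (intro has_bochner_integral_of_real) (simp add: has_bochner_integral_iff norm_abs_L2[OF that])
  have ig: "square_integrable (\<lambda>x. \<i> * g x)"
    using fg by (intro square_integrable_cmult)
  have "has_bochner_integral lebesgue
     (\<lambda>x. complex_of_real ((norm (f x + g x))\<^sup>2) - complex_of_real ((norm (f x - g x))\<^sup>2)
       + \<i> * complex_of_real ((norm (f x + \<i> * g x))\<^sup>2) - \<i> * complex_of_real ((norm (f x - \<i> * g x))\<^sup>2))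
     (complex_of_real ((norm (F + G))\<^sup>2) - complex_of_real ((norm (F - G))\<^sup>2)
     + \<i> * complex_of_real ((norm (F + L2_scaleC \<i> G))\<^sup>2) - \<i> * complex_of_real ((norm (F - L2_scaleC \<i> G))\<^sup>2))"
    unfolding F L2_scaleC_abs[OF fg(2)] abs_L2_add[OF fg] abs_L2_diff[OF fg] abs_L2_add[OF fg(1) ig] abs_L2_diff[OF fg(1) ig]
    by (intro has_bochner_integral_add has_bochner_integral_diff has_bochner_integral_mult_right norm
        square_integrable_add square_integrable_diff fg ig)
  moreover have "complex_of_real ((norm (z + w))\<^sup>2) - complex_of_real ((norm (z - w))\<^sup>2)
       + \<i> * complex_of_real ((norm (z + \<i> * w))\<^sup>2) - \<i> * complex_of_real ((norm (z - \<i> * w))\<^sup>2)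
      = 4 * (z * cnj w)" for z w
    unfolding complex_norm_square by (simp add: algebra_simps)
  ultimately show ?thesis
    using fg by (simp add: F L2_inner_abs has_bochner_integral_iff)
qed

lemma L2_inner_tendsto:
  assumes "(\<lambda>k. S k) \<longlonglongrightarrow> F" "(\<lambda>k. T k) \<longlonglongrightarrow> G"
  shows "(\<lambda>k. L2_inner (S k) (T k)) \<longlonglongrightarrow> L2_inner F G"
proof -
  have "(\<lambda>k. 4 * L2_inner (S k) (T k)) \<longlonglongrightarrow> 4 * L2_inner F G"
    unfolding L2_inner_polarization
    by (intro tendsto_intros bounded_linear.tendsto[OF bounded_linear_L2_scaleC] assms)
  then have "(\<lambda>k. 4 * L2_inner (S k) (T k) / 4) \<longlonglongrightarrow> 4 * L2_inner F G / 4"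
    by (rule tendsto_divide[OF _ tendsto_const]) simp
  then show ?thesis by simp
qed

lemma L2_inner_fourier_L2:
  fixes F G :: "'a::euclidean_space L2"
  shows "L2_inner (fourier_L2 F) (fourier_L2 G) = complex_of_real ((2 * pi) ^ DIM('a)) * L2_inner F G"
proof -
  interpret bounded_linear "fourier_L2 :: 'a L2 \<Rightarrow> 'a L2" by (rule bounded_linear_fourier_L2)
  have norm: "(norm (fourier_L2 H))\<^sup>2 = (2 * pi) ^ DIM('a) * (norm H)\<^sup>2" for H :: "'a L2"
    by (simp add: norm_fourier_L2 power_mult_distrib plancherel_constant_square[unfolded power_mult_distrib])
  have "4 * L2_inner (fourier_L2 F) (fourier_L2 G) = complex_of_real ((2 * pi) ^ DIM('a)) * (4 * L2_inner F G)"
    unfolding L2_inner_polarization fourier_L2_scaleC[symmetric] add[symmetric] diff[symmetric] norm of_real_mult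
    by (simp only: algebra_simps)
  then show ?thesis by simp
qed

lemma L2_inner_reflect: "L2_inner (L2_reflect F) (L2_reflect G) = L2_inner F G"
proof -
  obtain f g where fg: "square_integrable f" "square_integrable g"
    and F: "F = abs_L2 f" "G = abs_L2 g"
    by (metis L2_cases)
  note [measurable] = fg[THEN square_integrable_measurable]
  have "(\<integral>x. f x * cnj (g x) \<partial>lebesgue) = (\<integral>x. f x * cnj (g x) \<partial>distr lebesgue lebesgue uminus)"
    by (simp add: lebesgue_distr_uminus)
  also have "\<dots> = (\<integral>x. f (- x) * cnj (g (- x)) \<partial>lebesgue)"
    by (rule integral_distr) measurable
  finally show ?thesis
    using fg by (simp add: F L2_reflect_abs L2_inner_abs square_integrable_reflect)
qed

lemma bounded_linear_L2_reflect: "bounded_linear L2_reflect"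
proof (rule bounded_linear_intro)
  fix F G :: "'a L2" and r :: real
  obtain f g where fg: "square_integrable f" "square_integrable g"
    and F: "F = abs_L2 f" "G = abs_L2 g"
    by (metis L2_cases)
  show "L2_reflect (F + G) = L2_reflect F + L2_reflect G"
    unfolding F using fg by (simp add: abs_L2_add L2_reflect_abs square_integrable_add square_integrable_reflect)
  show "L2_reflect (r *\<^sub>R F) = r *\<^sub>R L2_reflect F"
    unfolding F scaleR_L2_def using fg
    by (simp add: L2_scaleC_abs L2_reflect_abs square_integrable_cmult square_integrable_reflect)
  have "complex_of_real ((norm (L2_reflect F))\<^sup>2) = complex_of_real ((norm F)\<^sup>2)"
    unfolding L2_inner_self[symmetric] by (rule L2_inner_reflect)
  then have "(norm (L2_reflect F))\<^sup>2 = (norm F)\<^sup>2"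
    by (simp only: of_real_eq_iff)
  then show "norm (L2_reflect F) \<le> norm F * 1"
    by (simp add: power2_eq_iff_nonneg)
qed

section \<open>The adjoint and inversion\<close>

text \<open>This is the multiplication formula for \<open>f\<close> and the conjugate of \<open>g\<close>, as conjugation
  turns the transform of \<open>g\<close> into the reflected transform of the conjugate.\<close>

lemma fourier_adjoint_L1_L2:
  fixes f g :: "'a::euclidean_space \<Rightarrow> complex"
  assumes f: "integrable lebesgue f" "square_integrable f"
    and g: "integrable lebesgue g" "square_integrable g"
  shows "(\<integral>x. fourier f x * cnj (g x) \<partial>lebesgue) = (\<integral>x. f x * cnj (fourier g (- x)) \<partial>lebesgue)"
proof -
  obtain f' where f': "integrable lborel f'" "AE x in lebesgue. f x = f' x" "fourier f = fourier f'"
    using borel_representative_L1_L2[OF f] by metis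
  obtain g' where g': "integrable lborel g'" "AE x in lebesgue. g x = g' x" "fourier g = fourier g'"
    using borel_representative_L1_L2[OF g] by metis
  note [measurable] = borel_measurable_integrable[OF f'(1)] borel_measurable_integrable[OF g'(1)]
    borel_measurable_integrable[OF f(1)] borel_measurable_integrable[OF g(1)]
  have [measurable]: "fourier f' \<in> borel_measurable borel" "fourier g' \<in> borel_measurable borel"
    "fourier (\<lambda>x. cnj (g' x)) \<in> borel_measurable borel"
    by (intro fourier_measurable; measurable)+
  have leb: "h \<in> borel_measurable lebesgue" if "h \<in> borel_measurable borel" for h :: "'a \<Rightarrow> complex"
    using that by (intro measurable_completion) simp
  have [measurable]: "fourier f' \<in> borel_measurable lebesgue" "f' \<in> borel_measurable lebesgue"
    "g' \<in> borel_measurable lebesgue" "fourier (\<lambda>x. cnj (g' x)) \<in> borel_measurable lebesgue"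
    by (intro leb; measurable)+
  have "(\<integral>x. fourier f x * cnj (g x) \<partial>lebesgue) = (\<integral>x. fourier f' x * cnj (g' x) \<partial>lebesgue)"
  proof (rule integral_cong_AE)
    show "AE x in lebesgue. fourier f x * cnj (g x) = fourier f' x * cnj (g' x)"
      using g'(2) by eventually_elim (simp add: f')
  qed (unfold f'(3), measurable)
  also have "\<dots> = (\<integral>x. fourier f' x * cnj (g' x) \<partial>lborel)"
    by (rule integral_completion) measurable
  also have "\<dots> = (\<integral>x. f' x * fourier (\<lambda>x. cnj (g' x)) x \<partial>lborel)"
    using f' g' by (intro fourier_multiplication_formula) auto
  also have "\<dots> = (\<integral>x. f' x * fourier (\<lambda>x. cnj (g' x)) x \<partial>lebesgue)"
    by (rule integral_completion[symmetric]) measurable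
  also have "\<dots> = (\<integral>x. f x * fourier (\<lambda>x. cnj (g' x)) x \<partial>lebesgue)"
  proof (rule integral_cong_AE)
    show "AE x in lebesgue. f' x * fourier (\<lambda>x. cnj (g' x)) x = f x * fourier (\<lambda>x. cnj (g' x)) x"
      using f'(2) by eventually_elim simp
  qed measurable
  also have "\<dots> = (\<integral>x. f x * cnj (fourier g (- x)) \<partial>lebesgue)"
    by (simp add: g'(3) cnj_fourier_uminus)
  finally show ?thesis .
qed

lemma fourier_L2_adjoint:
  fixes F G :: "'a::euclidean_space L2"
  shows "L2_inner (fourier_L2 F) G = L2_inner F (L2_reflect (fourier_L2 G))"
proof -
  obtain s where s: "\<And>k. integrable lebesgue (s k)" "\<And>k. square_integrable (s k)"
    "\<And>k x. norm (s k x) \<le> real k" and S: "(\<lambda>k. abs_L2 (s k)) \<longlonglongrightarrow> F"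
    using L2_dense[of F] by blast
  obtain t where t: "\<And>k. integrable lebesgue (t k)" "\<And>k. square_integrable (t k)"
    "\<And>k x. norm (t k x) \<le> real k" and T: "(\<lambda>k. abs_L2 (t k)) \<longlonglongrightarrow> G"
    using L2_dense[of G] by blast
  note lim = bounded_linear.tendsto[OF bounded_linear_fourier_L2]
  have "L2_inner (fourier_L2 (abs_L2 (s k))) (abs_L2 (t k))
      = L2_inner (abs_L2 (s k)) (L2_reflect (fourier_L2 (abs_L2 (t k))))" for k
    using fourier_adjoint_L1_L2[OF s(1,2) t(1,2), of k k]
    by (simp add: fourier_L2_abs L2_inner_abs L2_reflect_abs s t square_integrable_fourier square_integrable_reflect)
  moreover have "(\<lambda>k. L2_inner (fourier_L2 (abs_L2 (s k))) (abs_L2 (t k))) \<longlonglongrightarrow> L2_inner (fourier_L2 F) G"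
    by (intro L2_inner_tendsto lim S T)
  moreover have "(\<lambda>k. L2_inner (abs_L2 (s k)) (L2_reflect (fourier_L2 (abs_L2 (t k)))))
      \<longlonglongrightarrow> L2_inner F (L2_reflect (fourier_L2 G))"
    by (intro L2_inner_tendsto lim S T bounded_linear.tendsto[OF bounded_linear_L2_reflect])
  ultimately show ?thesis
    using LIMSEQ_unique by simp
qed

text \<open>Let \<open>F\<^sup>*\<close> be the adjoint of the transform.  The left-hand side is \<open>F\<^sup>*\<close> after the
  transform, and preservation of inner products evaluates this composition.\<close>

lemma reflect_fourier_fourier_L2:
  fixes F :: "'a::euclidean_space L2"
  shows "L2_reflect (fourier_L2 (fourier_L2 F)) = (2 * pi) ^ DIM('a) *\<^sub>R F"
proof (rule L2_eq_scaleR_I)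
  fix H :: "'a L2"
  show "L2_inner H (L2_reflect (fourier_L2 (fourier_L2 F))) = complex_of_real ((2 * pi) ^ DIM('a)) * L2_inner H F"
    unfolding fourier_L2_adjoint[of H "fourier_L2 F", symmetric] by (rule L2_inner_fourier_L2)
qed

text \<open>Moving the outer transform to the other side of an inner product makes both arguments reflected
  transforms; the reflection preserves inner products and can be dropped.\<close>

lemma fourier_reflect_fourier_L2:
  fixes F :: "'a::euclidean_space L2"
  shows "fourier_L2 (L2_reflect (fourier_L2 F)) = (2 * pi) ^ DIM('a) *\<^sub>R F"
proof (rule L2_eq_scaleR_I)
  fix H :: "'a L2"
  have "L2_inner (fourier_L2 (L2_reflect (fourier_L2 F))) H = complex_of_real ((2 * pi) ^ DIM('a)) * L2_inner F H"
    unfolding fourier_L2_adjoint[of "L2_reflect (fourier_L2 F)" H] L2_inner_reflect by (rule L2_inner_fourier_L2)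
  then show "L2_inner H (fourier_L2 (L2_reflect (fourier_L2 F))) = complex_of_real ((2 * pi) ^ DIM('a)) * L2_inner H F"
    unfolding L2_inner_commute[of H] by (simp only: complex_cnj_mult complex_cnj_complex_of_real)
qed

lemma inverse_fourier_fourier_L2: "inverse_fourier_L2 (fourier_L2 F) = F"
  by (simp add: inverse_fourier_L2_def reflect_fourier_fourier_L2 del: power_mult_distrib)

lemma fourier_inverse_fourier_L2: "fourier_L2 (inverse_fourier_L2 G) = G"
  unfolding inverse_fourier_L2_def linear_simps(5)[OF bounded_linear_fourier_L2] fourier_reflect_fourier_L2
  by simp

theorem theorem17p1:
  shows "(\<exists>C. \<forall>f :: 'a::euclidean_space \<Rightarrow> complex.
            integrable lebesgue f \<and> square_integrable f \<longrightarrow>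
              square_integrable (fourier f) \<and>
              norm (abs_L2 (fourier f)) \<le> C * norm (abs_L2 f)) \<and>
         (\<exists>!F :: 'a L2 \<Rightarrow> 'a L2. bounded_clinear_L2 F \<and> extends_fourier F) \<and>
         bij (fourier_L2 :: 'a L2 \<Rightarrow> 'a L2) \<and>
         (\<forall>f :: 'a L2. norm f = (2 * pi) powr (- (real DIM('a) / 2)) * norm (fourier_L2 f)) \<and>
         (\<forall>f g :: 'a L2. L2_inner f g =
            complex_of_real ((2 * pi) powr (- real DIM('a))) * L2_inner (fourier_L2 f) (fourier_L2 g)) \<and>
         (\<forall>f :: 'a L2. inverse_fourier_L2 (fourier_L2 f) = f) \<and>
         (\<forall>g :: 'a L2. fourier_L2 (inverse_fourier_L2 g) = g)"
proof (intro conjI allI)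
  show "\<exists>C. \<forall>f :: 'a \<Rightarrow> complex. integrable lebesgue f \<and> square_integrable f \<longrightarrow>
      square_integrable (fourier f) \<and> norm (abs_L2 (fourier f)) \<le> C * norm (abs_L2 f)"
    using square_integrable_fourier norm_abs_L2_fourier_le by blast
  show "\<exists>!F :: 'a L2 \<Rightarrow> 'a L2. bounded_clinear_L2 F \<and> extends_fourier F"
    by (rule ex1_fourier_L2)
  show "bij (fourier_L2 :: 'a L2 \<Rightarrow> 'a L2)"
    by (rule o_bij[of inverse_fourier_L2])
       (simp_all add: fun_eq_iff inverse_fourier_fourier_L2 fourier_inverse_fourier_L2)
  show "norm f = (2 * pi) powr (- (real DIM('a) / 2)) * norm (fourier_L2 f)" for f :: "'a L2"
  proof -
    have "plancherel_constant TYPE('a) = (2 * pi) powr (real DIM('a) / 2)"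
      using powr_powr[of "2 * pi" "real DIM('a)" "1 / 2"] powr_half_sqrt[of "(2 * pi) ^ DIM('a)"]
        powr_realpow[of "2 * pi" "DIM('a)"]
      by (simp only: plancherel_constant_def) simp
    then show ?thesis
      by (simp add: norm_fourier_L2 powr_minus)
  qed
  show "L2_inner f g = complex_of_real ((2 * pi) powr (- real DIM('a))) *
      L2_inner (fourier_L2 f) (fourier_L2 g)" for f g :: "'a L2"
  proof -
    have "(2 * pi) powr (- real DIM('a)) * (2 * pi) ^ DIM('a) = 1"
      using powr_realpow[of "2 * pi" "DIM('a)", symmetric] powr_add[of "2 * pi" "- real DIM('a)" "real DIM('a)", symmetric]
      by simp
    then have "complex_of_real ((2 * pi) powr (- real DIM('a))) * complex_of_real ((2 * pi) ^ DIM('a)) = 1"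
      unfolding of_real_mult[symmetric] by (simp only: of_real_1)
    then show ?thesis
      by (simp only: L2_inner_fourier_L2 mult.assoc[symmetric] mult_1_left)
  qed
qed (rule inverse_fourier_fourier_L2 fourier_inverse_fourier_L2)+

end
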